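(* Let $\{s_n\}$ be an infinite sequence of pairwise distinct real numbers, $s_n\neq0$, with $|s_n|\to0$ as $|n|\to\infty$, and let $\mathcal{A}_0$ be a compact selfadjoint operator on a Hilbert space with simple point spectrum $\{s_n\}$ (that is, the set of eigenvalues of $\mathcal{A}_0$ is exactly $\{s_n\}$ and each eigenvalue is simple). The following are equivalent: (i) There exists a rank one perturbation $\mathcal{L}_0=\mathcal{A}_0+a_0b_0^*$ such that $\mathcal{L}_0$ is a Volterra operator; (ii) The points $t_n=s_n^{-1}$ form the zero set of some function $F\in\mathcal{K}_1$.
   Context: For vectors $a_0,b_0$ in the (complex) Hilbert space, $a_0b_0^*$ denotes the operator $f\mapsto (f,b_0)\,a_0$. A compact operator is called a Volterra operator if its spectrum equals $\{0\}$. Krein class. An entire function $F$ with $F(0)\neq0$ belongs to the Krein class $\mathcal{K}_1$ if it is real on $\mathbb{R}$, has only real simple zeros $t_n$, and may be represented as $$\frac{1}{F(z)}=q+\sum_n c_n\Big(\frac{1}{t_n-z}-\frac{1}{t_n}\Big),\qquad \sum_n t_n^{-2}|c_n|<\infty,$$ where $c_n=-1/F'(t_n)$ and $q=1/F(0)$. *)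

theory Defs
  imports "HOL-Complex_Analysis.Complex_Analysis"
begin

class complex_vector = real_vector +
  fixes scaleC :: "complex \<Rightarrow> 'a \<Rightarrow> 'a"  (infixr \<open>*\<^sub>C\<close> 75)
  assumes scaleC_add_right: "c *\<^sub>C (x + y) = c *\<^sub>C x + c *\<^sub>C y"
    and scaleC_add_left: "(c + d) *\<^sub>C x = c *\<^sub>C x + d *\<^sub>C x"
    and scaleC_scaleC: "c *\<^sub>C (d *\<^sub>C x) = (c * d) *\<^sub>C x"
    and scaleR_scaleC: "r *\<^sub>R x = complex_of_real r *\<^sub>C x"

global_interpretation complex_vector: vector_space "scaleC :: complex \<Rightarrow> 'a \<Rightarrow> 'a::complex_vector"
proof
  show "(1::complex) *\<^sub>C x = x" for x :: 'a
    using scaleR_scaleC[of 1 x] by simp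
qed (simp_all add: scaleC_add_right scaleC_add_left scaleC_scaleC)

text \<open>
  The complex inner product is linear in its first argument. Its real part is the real inner
  product, so positive definiteness and \<open>norm x = sqrt (Re (cinner x x))\<close> are inherited from
  the class \<open>real_inner\<close>.
\<close>
class complex_inner = complex_vector + real_inner +
  fixes cinner :: "'a \<Rightarrow> 'a \<Rightarrow> complex"
  assumes cinner_add_left: "cinner (x + y) z = cinner x z + cinner y z"
    and cinner_scaleC_left: "cinner (c *\<^sub>C x) y = c * cinner x y"
    and cinner_commute: "cinner x y = cnj (cinner y x)"
    and inner_eq_Re_cinner: "inner x y = Re (cinner x y)"

class complex_hilbert_space = complex_inner + banach

instantiation complex :: complex_hilbert_space
begin

definition scaleC_complex :: "complex \<Rightarrow> complex \<Rightarrow> complex" where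
  "scaleC_complex c x = c * x"

definition cinner_complex :: "complex \<Rightarrow> complex \<Rightarrow> complex" where
  "cinner_complex x y = x * cnj y"

instance
  by standard
    (auto simp: scaleC_complex_def cinner_complex_def inner_complex_def algebra_simps scaleR_conv_of_real)

end

definition bounded_clinear :: "('a::complex_hilbert_space \<Rightarrow> 'a) \<Rightarrow> bool" where
  "bounded_clinear T \<longleftrightarrow> bounded_linear T \<and> (\<forall>c x. T (c *\<^sub>C x) = c *\<^sub>C T x)"

definition compact_operator :: "('a::complex_hilbert_space \<Rightarrow> 'a) \<Rightarrow> bool" where
  "compact_operator T \<longleftrightarrow> bounded_clinear T \<and> (\<forall>S. bounded S \<longrightarrow> compact (closure (T ` S)))"

definition selfadjoint :: "('a::complex_hilbert_space \<Rightarrow> 'a) \<Rightarrow> bool" where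
  "selfadjoint T \<longleftrightarrow> bounded_clinear T \<and> (\<forall>x y. cinner (T x) y = cinner x (T y))"

definition op_spectrum :: "('a::complex_hilbert_space \<Rightarrow> 'a) \<Rightarrow> complex set" where
  "op_spectrum T = {\<mu>. \<not> (\<exists>R. bounded_clinear R \<and>
     (\<forall>x. R (T x - \<mu> *\<^sub>C x) = x) \<and> (\<forall>x. T (R x) - \<mu> *\<^sub>C R x = x))}"

definition eigenspace :: "('a::complex_hilbert_space \<Rightarrow> 'a) \<Rightarrow> complex \<Rightarrow> 'a set" where
  "eigenspace T \<mu> = {x. T x = \<mu> *\<^sub>C x}"

definition point_spectrum :: "('a::complex_hilbert_space \<Rightarrow> 'a) \<Rightarrow> complex set" where
  "point_spectrum T = {\<mu>. \<exists>x. x \<noteq> 0 \<and> x \<in> eigenspace T \<mu>}"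

definition simple_point_spectrum :: "('a::complex_hilbert_space \<Rightarrow> 'a) \<Rightarrow> bool" where
  "simple_point_spectrum T \<longleftrightarrow> (\<forall>\<mu>\<in>point_spectrum T. complex_vector.dim (eigenspace T \<mu>) = 1)"

definition volterra :: "('a::complex_hilbert_space \<Rightarrow> 'a) \<Rightarrow> bool" where
  "volterra T \<longleftrightarrow> compact_operator T \<and> op_spectrum T = {0}"

text \<open>The operator \<open>a b\<^sup>*\<close>; it has rank one iff \<open>a\<close> and \<open>b\<close> are both nonzero.\<close>
definition rank_one_op ::
    "'a::complex_hilbert_space \<Rightarrow> 'a \<Rightarrow> ('a \<Rightarrow> 'a)" where
  "rank_one_op a b = (\<lambda>f. cinner f b *\<^sub>C a)"

text \<open>
  The sums in the Krein class run over the zero set of \<open>F\<close> itself. Summability of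
  \<open>|c t| / |t|\<^sup>2\<close> makes the partial fraction series absolutely convergent, so
  the unordered sum \<open>has_sum\<close> does not depend on an enumeration of the zeros.
\<close>
definition krein_class :: "(complex \<Rightarrow> complex) set" where
  "krein_class = {F. F holomorphic_on UNIV \<and> F 0 \<noteq> 0 \<and>
     (\<forall>x::real. F (of_real x) \<in> \<real>) \<and>
     (\<forall>z. F z = 0 \<longrightarrow> z \<in> \<real> \<and> zorder F z = 1) \<and>
     (let Z = {t. F t = 0}; c = (\<lambda>t. - 1 / deriv F t); q = 1 / F 0 in
        (\<lambda>t. norm (c t) / (norm t)\<^sup>2) summable_on Z \<and>
        (\<forall>z. z \<notin> Z \<longrightarrow>
           (\<exists>S. ((\<lambda>t. c t * (1 / (t - z) - 1 / t)) has_sum S) Z \<and> 1 / F z = q + S)))}"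

end

theory Submission
  imports Defs
begin

text \<open>
  Let \<open>e n\<close> be an orthonormal basis with \<open>A e n = s n e n\<close> and put \<open>d n = a\<^sub>n cnj b\<^sub>n\<close>. Since
  \<open>L = A + a b\<^sup>*\<close> is compact, it is a Volterra operator iff it has no nonzero eigenvalue, and solving
  the eigenvalue equation in coordinates shows that this happens iff all \<open>d n\<close> are nonzero and
  \<open>\<phi>(z) = 1 - \<Sum> d n z / (1 - s n z)\<close> has no zeros. In other words, \<open>1 / \<phi>\<close> is an entire function
  whose zeros are simple and are the points \<open>t n = 1 / s n\<close> (\<open>volterra_iff_zero_free\<close>). Every
  absolutely summable family \<open>d\<close> arises from some \<open>a\<close> and \<open>b\<close>. Up to the factor \<open>F(0)\<close>, a function
  \<open>F\<close> of Krein's class is therefore of the form \<open>1 / \<phi>\<close>, and it yields a Volterra perturbation.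

  In the other direction there is one difficulty: the \<open>d n\<close> need not be real, so \<open>1 / \<phi>\<close> need not be
  real on the real axis. It becomes real after multiplication by an exponential. Let
  \<open>\<phi>\<^sup>*(z) = cnj \<phi>(cnj z)\<close>. The quotient \<open>\<phi> / \<phi>\<^sup>*\<close> is entire without zeros, hence equal to
  \<open>exp g\<close>, and the key point is that \<open>g\<close> is linear (\<open>phi_reflection\<close>). The reason is a two-sided bound
  \<open>|ln |\<phi>(z)|| \<le> K (1 + |z|)\<^sup>2 / |Im z|\<close>. From above it is read off the series. From below it is
  Harnack's inequality for \<open>- ln |\<phi>|\<close> in the half-planes, where \<open>\<phi>\<close> is zero-free and dominated by
  a zero-free product of three functions \<open>M + \<i>\<close> with \<open>Im M \<ge> 0\<close> (\<open>cauchy_series_lower_bound\<close>).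
  The resulting bound for \<open>Re g\<close> degenerates on the real axis, but for entire functions such a
  degeneration is harmless (\<open>growth_from_bound_off_real_axis\<close>), and \<open>g'\<close> turns out to be bounded.

  With \<open>g(z) = \<beta> z\<close> and \<open>\<beta>\<close> purely imaginary, \<open>G = exp (\<beta> z / 2) / \<phi>\<close> is real on the real axis and
  has the zeros \<open>t n\<close>. Since \<open>|1 / G|\<^sup>2 = |\<phi> \<phi>\<^sup>*|\<close>, its reciprocal grows no faster than the Cauchy series
  formed with its principal parts, and the same argument shows that \<open>1 / G\<close> is the
  sum of that series and the constant \<open>1\<close>. Thus \<open>G\<close> lies in Krein's class.
\<close>

section \<open>Complex inner products\<close>

lemma cinner_zero_left [simp]: "cinner 0 y = 0"
  using cinner_add_left[of 0 0 y] by simp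

lemma cinner_scaleC_right: "cinner x (c *\<^sub>C y) = cnj c * cinner x y"
  by (metis cinner_scaleC_left cinner_commute complex_cnj_mult)

lemma cinner_diff_left: "cinner (x - y) z = cinner x z - cinner y z"
  using cinner_add_left[of "x - y" y z] by simp

lemma cinner_self: "cinner x x = complex_of_real ((norm x)\<^sup>2)"
proof -
  have "Im (cinner x x) = 0"
    using cinner_commute[of x x] by (simp add: complex_eq_iff)
  then show ?thesis
    by (simp add: complex_eq_iff inner_eq_Re_cinner[symmetric] power2_norm_eq_inner)
qed

lemma norm_scaleC: "norm (c *\<^sub>C x) = norm c * norm (x::'a::complex_inner)"
proof -
  have "complex_of_real ((norm (c *\<^sub>C x))\<^sup>2) = c * cnj c * complex_of_real ((norm x)\<^sup>2)"
    unfolding cinner_self[symmetric] by (simp add: cinner_scaleC_left cinner_scaleC_right)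
  also have "\<dots> = complex_of_real ((norm c * norm x)\<^sup>2)"
    by (simp add: complex_norm_square[symmetric] power_mult_distrib)
  finally show ?thesis
    by (metis of_real_eq_iff power2_eq_imp_eq norm_ge_zero mult_nonneg_nonneg)
qed

lemma norm_cinner_le: "norm (cinner x y) \<le> norm x * norm y"
proof (cases "cinner x y = 0")
  case False
  define c where "c = cnj (cinner x y) / norm (cinner x y)"
  have c: "norm c = 1"
    using False by (simp add: c_def norm_divide)
  have "norm (cinner x y) = Re (c * cinner x y)"
    using False by (simp add: c_def complex_norm_square[symmetric] power2_eq_square mult.commute)
  also have "\<dots> = inner (c *\<^sub>C x) y"
    by (simp add: inner_eq_Re_cinner cinner_scaleC_left)
  also have "\<dots> \<le> norm (c *\<^sub>C x) * norm y"
    by (rule norm_cauchy_schwarz)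
  finally show ?thesis
    by (simp add: norm_scaleC c)
qed simp

lemma bounded_linear_cinner_left: "bounded_linear (\<lambda>x. cinner x y)"
proof (rule bounded_linear_intro[where K = "norm y"])
  show "cinner (r *\<^sub>R x) y = r *\<^sub>R cinner x y" for r x
    by (simp add: scaleR_scaleC[of r x] cinner_scaleC_left scaleR_conv_of_real)
qed (simp_all add: cinner_add_left norm_cinner_le)

lemma bounded_linear_scaleC_left: "bounded_linear (\<lambda>c. c *\<^sub>C (x::'a::complex_inner))"
  by (rule bounded_linear_intro[where K = "norm x"])
    (simp_all add: scaleC_add_left norm_scaleC scaleR_conv_of_real scaleR_scaleC[where 'a = 'a]
      scaleC_scaleC)

lemma bounded_linear_scaleC_right: "bounded_linear (\<lambda>x. c *\<^sub>C (x::'a::complex_inner))"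
  by (rule bounded_linear_intro[where K = "norm c"])
    (simp_all add: scaleC_add_right norm_scaleC scaleR_scaleC[where 'a = 'a] scaleC_scaleC mult.commute)

lemma scaleC_diff_right: "c *\<^sub>C (x - y) = c *\<^sub>C x - c *\<^sub>C (y::'a::complex_vector)"
  using scaleC_add_right[of c "x - y" y] by simp

section \<open>Compact operators and their nonzero spectrum\<close>

lemma bounded_clinearD:
  assumes "bounded_clinear T"
  shows "bounded_linear T" "T (c *\<^sub>C x) = c *\<^sub>C T x"
    "T (x + y) = T x + T y" "T (x - y) = T x - T y" "T 0 = 0"
  using assms bounded_linear.linear[of T]
  by (auto simp: bounded_clinear_def linear_add linear_diff linear_0)

lemma compact_operator_imp_bounded_clinear: "compact_operator T \<Longrightarrow> bounded_clinear T"
  by (simp add: compact_operator_def)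

lemma bounded_clinear_shift:
  assumes "bounded_clinear T"
  shows "bounded_clinear (\<lambda>x. T x - \<mu> *\<^sub>C x)"
  using assms unfolding bounded_clinear_def
  by (auto intro!: bounded_linear_sub bounded_linear_scaleC_right
      simp: scaleC_diff_right scaleC_scaleC mult.commute)

lemma compact_operator_subseq:
  fixes x :: "nat \<Rightarrow> 'a::complex_hilbert_space"
  assumes "compact_operator T" and "\<And>k. norm (x k) \<le> B"
  obtains y r where "strict_mono r" "(\<lambda>k. T (x (r k))) \<longlonglongrightarrow> y"
proof -
  have "bounded (range x)"
    using assms(2) by (auto simp: bounded_iff)
  then have "compact (closure (T ` range x))"
    using assms(1) by (simp add: compact_operator_def)
  then have "seq_compact (closure (T ` range x))"
    by (simp add: compact_eq_seq_compact_metric)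
  moreover have "\<forall>k. T (x k) \<in> closure (T ` range x)"
    by (intro allI set_mp[OF closure_subset] imageI rangeI)
  ultimately obtain y r where "strict_mono r" "((\<lambda>k. T (x k)) \<circ> r) \<longlonglongrightarrow> y"
    by (rule seq_compactE)
  then show thesis
    using that by (simp add: o_def)
qed

text \<open>
  Compactness is contradicted twice through bounded vectors whose images stay apart: in Riesz's
  argument and for orthonormal vectors.
\<close>
lemma compact_operator_not_separated:
  fixes x :: "nat \<Rightarrow> 'a::complex_hilbert_space"
  assumes T: "compact_operator T" and B: "\<And>k. norm (x k) \<le> B" and \<delta>: "\<delta> > 0"
    and sep: "\<And>j k. j < k \<Longrightarrow> \<delta> \<le> norm (T (x j) - T (x k))"
  shows False
proof -
  obtain y r where r: "strict_mono r" and "(\<lambda>k. T (x (r k))) \<longlonglongrightarrow> y"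
    using compact_operator_subseq[OF T B] .
  then have "Cauchy (\<lambda>k. T (x (r k)))"
    by (simp add: LIMSEQ_imp_Cauchy)
  then obtain N where "\<And>m n. m \<ge> N \<Longrightarrow> n \<ge> N \<Longrightarrow> dist (T (x (r m))) (T (x (r n))) < \<delta>"
    using \<delta> unfolding Cauchy_def by blast
  then have "dist (T (x (r N))) (T (x (r (Suc N)))) < \<delta>"
    by simp
  moreover have "r N < r (Suc N)"
    using r by (simp add: strict_mono_Suc_iff)
  ultimately show False
    using sep[of "r N" "r (Suc N)"] by (simp add: dist_norm)
qed

text \<open>
  Otherwise there are unit vectors \<open>x k\<close> with \<open>T (x k) - \<mu> x k \<rightarrow> 0\<close>. Along a subsequence \<open>T (x k)\<close>
  converges, hence so does \<open>\<mu> x k\<close>, and the limit is an eigenvector.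
\<close>
lemma compact_shift_bounded_below:
  fixes T :: "'a::complex_hilbert_space \<Rightarrow> 'a"
  assumes T: "compact_operator T" and \<mu>: "\<mu> \<noteq> 0" "\<mu> \<notin> point_spectrum T"
  obtains c :: real where "c > 0" "\<And>x. c * norm x \<le> norm (T x - \<mu> *\<^sub>C x)"
proof (rule ccontr)
  note lin = bounded_clinearD[OF compact_operator_imp_bounded_clinear[OF T]]
  assume "\<not> thesis"
  then have no: "\<exists>x. norm (T x - \<mu> *\<^sub>C x) < c * norm x" if "c > 0" for c
    using that \<open>\<And>c. c > 0 \<Longrightarrow> (\<And>x. c * norm x \<le> norm (T x - \<mu> *\<^sub>C x)) \<Longrightarrow> thesis\<close>
    by (force simp: not_le)
  have "\<exists>x. norm x = 1 \<and> norm (T x - \<mu> *\<^sub>C x) < inverse (real (Suc k))" for k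
  proof -
    obtain x where x: "norm (T x - \<mu> *\<^sub>C x) < inverse (real (Suc k)) * norm x"
      using no[of "inverse (real (Suc k))"] by auto
    then have x0: "norm x > 0"
      using lin(5) by (cases "x = 0") auto
    define u where "u = complex_of_real (inverse (norm x)) *\<^sub>C x"
    have "T u - \<mu> *\<^sub>C u = complex_of_real (inverse (norm x)) *\<^sub>C (T x - \<mu> *\<^sub>C x)"
      by (simp add: u_def lin scaleC_diff_right scaleC_scaleC mult.commute)
    then have "norm (T u - \<mu> *\<^sub>C u) = inverse (norm x) * norm (T x - \<mu> *\<^sub>C x)"
      by (simp only: norm_scaleC) (simp add: norm_inverse)
    moreover have "inverse (norm x) * norm (T x - \<mu> *\<^sub>C x) < inverse (real (Suc k))"
      using x x0 by (simp add: field_simps)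
    moreover have "norm u = 1"
      using x0 by (simp add: u_def norm_scaleC del: of_real_inverse)
    ultimately show ?thesis
      by auto
  qed
  then obtain x where x1: "\<And>k. norm (x k) = 1"
    and xk: "\<And>k. norm (T (x k) - \<mu> *\<^sub>C x k) < inverse (real (Suc k))"
    by metis
  have lim0: "(\<lambda>k. T (x k) - \<mu> *\<^sub>C x k) \<longlonglongrightarrow> 0"
    by (rule Lim_null_comparison[OF _ LIMSEQ_inverse_real_of_nat])
      (use xk in \<open>auto intro!: always_eventually less_imp_le\<close>)
  obtain y r where r: "strict_mono r" and y: "(\<lambda>k. T (x (r k))) \<longlonglongrightarrow> y"
    by (rule compact_operator_subseq[OF T, of x 1]) (auto simp: x1)
  have "(\<lambda>k. T (x (r k)) - (T (x (r k)) - \<mu> *\<^sub>C x (r k))) \<longlonglongrightarrow> y - 0"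
    using y LIMSEQ_subseq_LIMSEQ[OF lim0 r] by (intro tendsto_diff) (auto simp: o_def)
  then have mux: "(\<lambda>k. \<mu> *\<^sub>C x (r k)) \<longlonglongrightarrow> y"
    by simp
  have "(\<lambda>k. T (\<mu> *\<^sub>C x (r k))) \<longlonglongrightarrow> T y"
    by (rule bounded_linear.tendsto[OF lin(1) mux])
  moreover have "(\<lambda>k. T (\<mu> *\<^sub>C x (r k))) \<longlonglongrightarrow> \<mu> *\<^sub>C y"
    unfolding lin(2) by (rule bounded_linear.tendsto[OF bounded_linear_scaleC_right y])
  ultimately have "T y = \<mu> *\<^sub>C y"
    by (rule LIMSEQ_unique)
  moreover have "norm y = norm \<mu>"
    using tendsto_norm[OF mux] x1 by (simp add: norm_scaleC LIMSEQ_const_iff)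
  then have "y \<noteq> 0"
    using \<mu>(1) by auto
  ultimately show False
    using \<mu>(2) by (auto simp: point_spectrum_def eigenspace_def)
qed

text \<open>Riesz's lemma: \<open>u\<close> is the normalised difference of \<open>y\<close> and a nearly closest point of \<open>W\<close>.\<close>
lemma almost_orthogonal_unit:
  fixes V W :: "'a::real_normed_vector set"
  assumes "subspace V" "subspace W" "W \<subseteq> V" "closed W" "y \<in> V" "y \<notin> W"
  obtains u where "u \<in> V" "norm u = 1" "\<And>w. w \<in> W \<Longrightarrow> 1/2 \<le> norm (u - w)"
proof -
  have W0: "0 \<in> W"
    using assms by (simp add: subspace_0)
  define d where "d = infdist y W"
  have d: "d > 0"
    unfolding d_def using assms W0 infdist_pos_not_in_closed[of W y] by blast
  have "\<exists>v\<in>W. dist y v < 2 * d"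
  proof -
    have "(INF v\<in>W. dist y v) < 2 * d"
      using d W0 by (auto simp: d_def infdist_def split: if_splits)
    moreover have "bdd_below (dist y ` W)"
      by (rule bdd_belowI2[of _ 0]) simp
    ultimately show ?thesis
      using W0 by (subst (asm) cINF_less_iff) auto
  qed
  then obtain v where v: "v \<in> W" "dist y v < 2 * d" ..
  have yv: "norm (y - v) > 0"
    using v(1) assms(6) by auto
  define u where "u = (1 / norm (y - v)) *\<^sub>R (y - v)"
  show thesis
  proof
    show "u \<in> V"
      unfolding u_def using assms v by (intro subspace_scale subspace_diff) auto
    show "norm u = 1"
      using yv by (simp add: u_def)
    fix w assume w: "w \<in> W"
    have "v + norm (y - v) *\<^sub>R w \<in> W"
      using assms v w by (intro subspace_add subspace_scale) auto
    then have "d \<le> norm (y - (v + norm (y - v) *\<^sub>R w))"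
      unfolding d_def dist_norm[symmetric] by (rule infdist_le)
    also have "y - (v + norm (y - v) *\<^sub>R w) = norm (y - v) *\<^sub>R (u - w)"
      using yv by (simp add: u_def scaleR_diff_right)
    also have "norm \<dots> = norm (y - v) * norm (u - w)"
      by simp
    also have "\<dots> \<le> 2 * d * norm (u - w)"
      using v(2) by (intro mult_right_mono) (auto simp: dist_norm)
    finally show "1/2 \<le> norm (u - w)"
      using d by (simp add: field_simps)
  qed
qed

text \<open>
  Riesz's argument: if \<open>T - \<mu>\<close> is injective but misses a vector, the ranges of its powers strictly
  decrease, and unit vectors almost orthogonal to the next range have \<open>T\<close>-images that stay apart.
\<close>
lemma compact_shift_surj:
  fixes T :: "'a::complex_hilbert_space \<Rightarrow> 'a"
  assumes T: "compact_operator T" and \<mu>: "\<mu> \<noteq> 0" "\<mu> \<notin> point_spectrum T"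
  shows "surj (\<lambda>x. T x - \<mu> *\<^sub>C x)"
proof (rule ccontr)
  define S where "S = (\<lambda>x. T x - \<mu> *\<^sub>C x)"
  assume "\<not> surj (\<lambda>x. T x - \<mu> *\<^sub>C x)"
  then obtain y0 where y0: "y0 \<notin> range S"
    by (auto simp: S_def)
  have bS: "bounded_linear S"
    using bounded_clinear_shift[OF compact_operator_imp_bounded_clinear[OF T]]
    by (auto simp: S_def bounded_clinear_def)
  then interpret S: bounded_linear S .
  obtain c where c: "c > 0" "\<And>x. c * norm x \<le> norm (S x)"
    using compact_shift_bounded_below[OF T \<mu>] unfolding S_def by blast
  have inj: "inj S"
  proof (rule injI)
    fix x y assume "S x = S y"
    then have "S (x - y) = 0"
      by (simp add: S.diff)
    then show "x = y"
      using c(2)[of "x - y"] c(1) by (simp add: mult_le_0_iff)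
  qed
  define V where "V k = (S ^^ k) ` UNIV" for k
  have V0: "V 0 = UNIV" and VS: "V (Suc k) = S ` V k" for k
    by (auto simp: V_def image_comp)
  have sub: "subspace (V k)" for k
    by (induction k) (auto simp: V0 VS intro: S.linear_axioms linear_subspace_image)
  have cl: "complete (V k)" for k
  proof (induction k)
    case (Suc k)
    then show ?case
      unfolding VS using c sub bS by (intro complete_isometric_image[of c]) auto
  qed (simp add: V0 complete_UNIV)
  have dec: "V (Suc k) \<subseteq> V k" for k
  proof (induction k)
    case (Suc k)
    then show ?case
      by (subst (1 2) VS) (rule image_mono)
  qed (simp add: V0)
  then have mono: "V k \<subseteq> V j" if "j \<le> k" for j k
    using that lift_Suc_antimono_le[of V] by blast
  have strict: "(S ^^ k) y0 \<in> V k - V (Suc k)" for k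
  proof -
    have "(S ^^ k) y0 = (S ^^ k) (S x) \<Longrightarrow> y0 = S x" for x
      using inj_fn[OF inj, of k] by (rule injD)
    then show ?thesis
      using y0 by (auto simp: V_def funpow_swap1)
  qed
  have "\<exists>u. u \<in> V k \<and> norm u = 1 \<and> (\<forall>w\<in>V (Suc k). 1/2 \<le> norm (u - w))" for k
    using almost_orthogonal_unit[OF sub[of k] sub[of "Suc k"] dec complete_imp_closed[OF cl]] strict
    by (metis DiffD1 DiffD2)
  then obtain u where u: "\<And>k. u k \<in> V k" "\<And>k. norm (u k) = 1"
    and sep: "\<And>k w. w \<in> V (Suc k) \<Longrightarrow> 1/2 \<le> norm (u k - w)"
    by metis
  show False
  proof (rule compact_operator_not_separated[OF T, of u 1 "norm \<mu> / 2"])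
    fix j k :: nat assume jk: "j < k"
    define w where "w = S (u j) - S (u k) - \<mu> *\<^sub>C u k"
    have in1: "S (u i) \<in> V (Suc j)" if "j \<le> i" for i
      using u(1)[of i] mono[OF that] by (auto simp: VS)
    have "u k \<in> V (Suc j)"
      using u(1)[of k] mono[of "Suc j" k] jk by auto
    moreover have scaleC_V: "d *\<^sub>C x \<in> V i" if "x \<in> V i" for d x i
      using that
    proof (induction i arbitrary: x)
      case (Suc i)
      then obtain x' where "x' \<in> V i" "x = S x'"
        by (auto simp: VS)
      moreover have "S (d *\<^sub>C x') = d *\<^sub>C S x'"
        using bounded_clinear_shift[OF compact_operator_imp_bounded_clinear[OF T]]
        by (simp add: S_def bounded_clinear_def)
      ultimately show ?case
        using Suc.IH by (metis VS imageI)
    qed (simp add: V0)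
    ultimately have "w \<in> V (Suc j)"
      unfolding w_def using in1 jk sub by (intro subspace_diff) auto
    then have "(-1 / \<mu>) *\<^sub>C w \<in> V (Suc j)"
      by (rule scaleC_V)
    then have "norm \<mu> * (1/2) \<le> norm \<mu> * norm (u j - (-1 / \<mu>) *\<^sub>C w)"
      by (intro mult_left_mono sep) auto
    also have "\<dots> = norm (\<mu> *\<^sub>C (u j - (-1 / \<mu>) *\<^sub>C w))"
      by (simp add: norm_scaleC)
    also have "\<mu> *\<^sub>C (u j - (-1 / \<mu>) *\<^sub>C w) = \<mu> *\<^sub>C u j + w"
      using \<mu>(1) by (simp add: scaleC_diff_right scaleC_add_right scaleC_scaleC)
    also have "\<dots> = T (u j) - T (u k)"
      by (simp add: w_def S_def)
    finally show "norm \<mu> / 2 \<le> norm (T (u j) - T (u k))"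
      by simp
  qed (use \<mu> u in auto)
qed

text \<open>
  The Riesz-Schauder theorem. It reduces the Volterra property of a compact operator to the absence
  of nonzero eigenvalues.
\<close>
lemma compact_spectrum_nonzero:
  fixes T :: "'a::complex_hilbert_space \<Rightarrow> 'a"
  assumes T: "compact_operator T" and \<mu>: "\<mu> \<noteq> 0"
  shows "\<mu> \<in> op_spectrum T \<longleftrightarrow> \<mu> \<in> point_spectrum T"
proof
  note lin = bounded_clinearD[OF compact_operator_imp_bounded_clinear[OF T]]
  assume "\<mu> \<in> point_spectrum T"
  then obtain x where x: "x \<noteq> 0" "T x - \<mu> *\<^sub>C x = 0"
    by (auto simp: point_spectrum_def eigenspace_def)
  have "R (T x - \<mu> *\<^sub>C x) \<noteq> x" if "bounded_clinear R" for R
    using x bounded_clinearD(5)[OF that] by auto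
  then show "\<mu> \<in> op_spectrum T"
    by (auto simp: op_spectrum_def)
next
  assume spec: "\<mu> \<in> op_spectrum T"
  show "\<mu> \<in> point_spectrum T"
  proof (rule ccontr)
    assume np: "\<mu> \<notin> point_spectrum T"
    define S where "S = (\<lambda>x. T x - \<mu> *\<^sub>C x)"
    have S: "bounded_clinear S"
      unfolding S_def by (rule bounded_clinear_shift[OF compact_operator_imp_bounded_clinear[OF T]])
    note linS = bounded_clinearD[OF S]
    obtain c where c: "c > 0" "\<And>x. c * norm x \<le> norm (S x)"
      using compact_shift_bounded_below[OF T \<mu> np] unfolding S_def by blast
    have surj: "surj S"
      unfolding S_def by (rule compact_shift_surj[OF T \<mu> np])
    have inj: "x = y" if "S x = S y" for x y
      using c(2)[of "x - y"] c(1) that by (simp add: linS mult_le_0_iff)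
    define R where "R = inv S"
    have SR: "S (R y) = y" for y
      unfolding R_def by (rule surj_f_inv_f[OF surj])
    have RS: "R (S x) = x" for x
      by (rule inj) (rule SR)
    have "bounded_linear R"
    proof (rule bounded_linear_intro[where K = "1 / c"])
      show "R (x + y) = R x + R y" for x y
        by (rule inj) (simp add: SR linS)
      show "R (r *\<^sub>R x) = r *\<^sub>R R x" for r x
        by (rule inj) (simp add: SR linS scaleR_scaleC)
      show "norm (R x) \<le> norm x * (1 / c)" for x
        using c(2)[of "R x"] c(1) by (simp add: SR field_simps)
    qed
    moreover have "R (d *\<^sub>C x) = d *\<^sub>C R x" for d x
      by (rule inj) (simp add: SR linS)
    ultimately have "bounded_clinear R"
      by (simp add: bounded_clinear_def)
    then show False
      using spec SR RS by (auto simp: op_spectrum_def S_def)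
  qed
qed

text \<open>The image of a bounded set lies in the sum of two compact sets.\<close>
lemma compact_operator_add_rank_one:
  fixes T :: "'a::complex_hilbert_space \<Rightarrow> 'a"
  assumes T: "compact_operator T"
  shows "compact_operator (\<lambda>x. T x + rank_one_op a b x)"
  unfolding compact_operator_def
proof safe
  note lin = bounded_clinearD[OF compact_operator_imp_bounded_clinear[OF T]]
  show "bounded_clinear (\<lambda>x. T x + rank_one_op a b x)"
    unfolding bounded_clinear_def
  proof safe
    show "bounded_linear (\<lambda>x. T x + rank_one_op a b x)"
      unfolding rank_one_op_def
      by (intro bounded_linear_add lin
          bounded_linear_compose[OF bounded_linear_scaleC_left bounded_linear_cinner_left])
  qed (simp add: lin rank_one_op_def cinner_scaleC_left scaleC_add_right scaleC_scaleC)
  fix S :: "'a set" assume S: "bounded S"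
  then obtain B where B: "\<And>x. x \<in> S \<Longrightarrow> norm x \<le> B"
    by (auto simp: bounded_iff)
  define K where "K = {x + y |x y. x \<in> closure (T ` S) \<and> y \<in> (\<lambda>c. c *\<^sub>C a) ` cball 0 (B * norm b)}"
  have K: "compact K"
    unfolding K_def
  proof (rule compact_sums)
    show "compact (closure (T ` S))"
      using T S by (simp add: compact_operator_def)
    show "compact ((\<lambda>c. c *\<^sub>C a) ` cball 0 (B * norm b))"
      by (intro compact_continuous_image linear_continuous_on bounded_linear_scaleC_left compact_cball)
  qed
  have "T x + rank_one_op a b x \<in> K" if "x \<in> S" for x
  proof -
    have "T x \<in> closure (T ` S)"
      by (intro set_mp[OF closure_subset] imageI that)
    moreover have "norm (cinner x b) \<le> B * norm b"
      using norm_cinner_le[of x b] mult_right_mono[OF B[OF that] norm_ge_zero[of b]] by linarith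
    then have "rank_one_op a b x \<in> (\<lambda>c. c *\<^sub>C a) ` cball 0 (B * norm b)"
      unfolding rank_one_op_def by (intro imageI) simp
    ultimately show ?thesis
      unfolding K_def mem_Collect_eq
      by (intro exI[of _ "T x"] exI[of _ "rank_one_op a b x"] conjI) auto
  qed
  then have "closure ((\<lambda>x. T x + rank_one_op a b x) ` S) \<subseteq> K"
    by (intro closure_minimal compact_imp_closed[OF K] image_subsetI)
  then have "K \<inter> closure ((\<lambda>x. T x + rank_one_op a b x) ` S) = closure ((\<lambda>x. T x + rank_one_op a b x) ` S)"
    by (rule Int_absorb1)
  then show "compact (closure ((\<lambda>x. T x + rank_one_op a b x) ` S))"
    using compact_Int_closed[OF K closed_closure[of "(\<lambda>x. T x + rank_one_op a b x) ` S"]] by simp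
qed

section \<open>Orthonormal bases\<close>

lemma cinner_sum_left: "cinner (\<Sum>n\<in>F. f n) y = (\<Sum>n\<in>F. cinner (f n) y)"
  by (induction F rule: infinite_finite_induct) (simp_all add: cinner_add_left)

lemma summable_on_tail_small:
  fixes g :: "'i \<Rightarrow> real"
  assumes "g summable_on A" "\<epsilon> > 0"
  obtains F where "finite F" "F \<subseteq> A" "\<And>X. finite X \<Longrightarrow> X \<subseteq> A - F \<Longrightarrow> sum g X < \<epsilon>"
proof -
  obtain L where "(sum g \<longlongrightarrow> L) (finite_subsets_at_top A)"
    using assms(1) unfolding summable_on_def has_sum_def by blast
  then have "\<forall>\<^sub>F Y in finite_subsets_at_top A. dist (sum g Y) L < \<epsilon> / 2"
    using assms(2) by (intro tendstoD) auto
  then have "\<exists>F. finite F \<and> F \<subseteq> A \<and>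
      (\<forall>Y. finite Y \<and> F \<subseteq> Y \<and> Y \<subseteq> A \<longrightarrow> dist (sum g Y) L < \<epsilon> / 2)"
    by (simp only: eventually_finite_subsets_at_top)
  then obtain F where F: "finite F" "F \<subseteq> A"
    and FY: "\<And>Y. finite Y \<Longrightarrow> F \<subseteq> Y \<Longrightarrow> Y \<subseteq> A \<Longrightarrow> dist (sum g Y) L < \<epsilon> / 2"
    by metis
  have "sum g X < \<epsilon>" if X: "finite X" "X \<subseteq> A - F" for X
  proof -
    have "sum g (F \<union> X) = sum g F + sum g X"
      using X F by (intro sum.union_disjoint) auto
    moreover have "dist (sum g (F \<union> X)) L < \<epsilon> / 2" "dist (sum g F) L < \<epsilon> / 2"
      using X F by (intro FY; auto)+
    ultimately show ?thesis
      unfolding dist_real_def by arith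
  qed
  then show thesis
    using F that by blast
qed

locale orthonormal_basis =
  fixes I :: "'i set" and e :: "'i \<Rightarrow> 'a::complex_hilbert_space"
  assumes norm_e: "n \<in> I \<Longrightarrow> norm (e n) = 1"
    and orth: "m \<in> I \<Longrightarrow> n \<in> I \<Longrightarrow> m \<noteq> n \<Longrightarrow> cinner (e m) (e n) = 0"
    and total: "(\<And>n. n \<in> I \<Longrightarrow> cinner x (e n) = 0) \<Longrightarrow> x = 0"
begin

lemma cinner_e: "m \<in> I \<Longrightarrow> n \<in> I \<Longrightarrow> cinner (e m) (e n) = (if m = n then 1 else 0)"
  by (auto simp: orth cinner_self norm_e)

lemma norm_sum_e:
  assumes "finite F" "F \<subseteq> I"
  shows "(norm (\<Sum>n\<in>F. \<alpha> n *\<^sub>C e n))\<^sup>2 = (\<Sum>n\<in>F. (norm (\<alpha> n))\<^sup>2)"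
proof -
  have "(norm (\<Sum>n\<in>F. \<alpha> n *\<^sub>C e n))\<^sup>2 = (\<Sum>n\<in>F. (norm (\<alpha> n *\<^sub>C e n))\<^sup>2)"
  proof (rule norm_sum_Pythagorean[OF assms(1)])
    show "pairwise (\<lambda>i j. orthogonal (\<alpha> i *\<^sub>C e i) (\<alpha> j *\<^sub>C e j)) F"
      using assms orth
      by (auto simp: pairwise_def orthogonal_def inner_eq_Re_cinner cinner_scaleC_left
          cinner_scaleC_right subset_iff)
  qed
  also have "\<dots> = (\<Sum>n\<in>F. (norm (\<alpha> n))\<^sup>2)"
    using assms by (intro sum.cong) (auto simp: norm_scaleC norm_e subset_iff)
  finally show ?thesis .
qed

lemma eq_by_coordinates: "(\<And>n. n \<in> I \<Longrightarrow> cinner x (e n) = cinner y (e n)) \<Longrightarrow> x = y"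
  using total[of "x - y"] by (simp add: cinner_diff_left)

text \<open>
  The norm of a finite block of the series is the \<open>\<ell>\<^sup>2\<close> norm of its coefficients, so square
  summability is the Cauchy criterion.
\<close>
lemma riesz_fischer_has_sum:
  assumes "(\<lambda>n. (norm (\<alpha> n))\<^sup>2) summable_on I"
  obtains x where "((\<lambda>n. \<alpha> n *\<^sub>C e n) has_sum x) I"
proof -
  define f where "f = (\<lambda>n. \<alpha> n *\<^sub>C e n)"
  have "\<exists>P. eventually P (finite_subsets_at_top I) \<and>
      (\<forall>Y Y'. P Y \<and> P Y' \<longrightarrow> dist (sum f Y) (sum f Y') < \<epsilon>)" if "\<epsilon> > 0" for \<epsilon>
  proof -
    have e2: "(\<epsilon> / 2)\<^sup>2 > 0"
      using that by simp
    obtain F where F: "finite F" "F \<subseteq> I"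
      and tail: "\<And>X. finite X \<Longrightarrow> X \<subseteq> I - F \<Longrightarrow> (\<Sum>n\<in>X. (norm (\<alpha> n))\<^sup>2) < (\<epsilon> / 2)\<^sup>2"
      by (rule summable_on_tail_small[OF assms e2]) (rule that)
    have near: "dist (sum f Y) (sum f F) < \<epsilon> / 2" if "finite Y" "F \<subseteq> Y" "Y \<subseteq> I" for Y
    proof -
      have "sum f Y - sum f F = sum f (Y - F)"
        using that by (simp add: sum_diff)
      then have "(dist (sum f Y) (sum f F))\<^sup>2 = (\<Sum>n\<in>Y - F. (norm (\<alpha> n))\<^sup>2)"
        using that norm_sum_e[of "Y - F" \<alpha>] by (auto simp: dist_norm f_def)
      also have "\<dots> < (\<epsilon> / 2)\<^sup>2"
        using that by (intro tail) auto
      finally show ?thesis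
        by (rule power2_less_imp_less) (use \<open>\<epsilon> > 0\<close> in simp)
    qed
    have "dist (sum f Y) (sum f Y') < \<epsilon>"
      if "finite Y" "F \<subseteq> Y" "Y \<subseteq> I" "finite Y'" "F \<subseteq> Y'" "Y' \<subseteq> I" for Y Y'
      using near[of Y] near[of Y'] that dist_triangle_half_l[of "sum f Y" "sum f F" \<epsilon> "sum f Y'"]
      by auto
    moreover have "\<forall>\<^sub>F Y in finite_subsets_at_top I. finite Y \<and> F \<subseteq> Y \<and> Y \<subseteq> I"
      using F by (auto simp: eventually_finite_subsets_at_top)
    ultimately show ?thesis
      by (intro exI[of _ "\<lambda>Y. finite Y \<and> F \<subseteq> Y \<and> Y \<subseteq> I"]) auto
  qed
  then have "cauchy_filter (filtermap (sum f) (finite_subsets_at_top I))"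
    by (simp add: cauchy_filter_metric_filtermap)
  then obtain x where "(sum f \<longlongrightarrow> x) (finite_subsets_at_top I)"
    using complete_uniform[where S = "UNIV :: 'a set"] complete_UNIV
    by (force simp: filterlim_def)
  then show thesis
    using that unfolding has_sum_def f_def by blast
qed

lemma coordinate_of_has_sum:
  assumes "((\<lambda>n. \<alpha> n *\<^sub>C e n) has_sum x) I" "m \<in> I"
  shows "cinner x (e m) = \<alpha> m"
proof -
  have "((\<lambda>n. cinner (\<alpha> n *\<^sub>C e n) (e m)) has_sum cinner x (e m)) I"
    by (rule has_sum_bounded_linear[OF bounded_linear_cinner_left assms(1)])
  moreover have "((\<lambda>n. cinner (\<alpha> n *\<^sub>C e n) (e m)) has_sum \<alpha> m) I"
    by (rule has_sum_finite_neutralI[of "{m}"])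
      (use assms(2) in \<open>auto simp: cinner_scaleC_left cinner_e\<close>)
  ultimately show ?thesis
    by (rule has_sum_unique)
qed

lemma riesz_fischer:
  assumes "(\<lambda>n. (norm (\<alpha> n))\<^sup>2) summable_on I"
  obtains x where "\<And>n. n \<in> I \<Longrightarrow> cinner x (e n) = \<alpha> n"
  using riesz_fischer_has_sum[OF assms] coordinate_of_has_sum by metis

lemma bessel: "(\<lambda>n. (norm (cinner x (e n)))\<^sup>2) summable_on I"
proof (rule nonneg_bdd_above_summable_on)
  show "bdd_above (sum (\<lambda>n. (norm (cinner x (e n)))\<^sup>2) ` {F. F \<subseteq> I \<and> finite F})"
  proof (rule bdd_aboveI2)
    fix F assume "F \<in> {F. F \<subseteq> I \<and> finite F}"
    then have F: "finite F" "F \<subseteq> I" by auto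
    define p where "p = (\<Sum>n\<in>F. cinner x (e n) *\<^sub>C e n)"
    have p2: "(norm p)\<^sup>2 = (\<Sum>n\<in>F. (norm (cinner x (e n)))\<^sup>2)"
      unfolding p_def by (rule norm_sum_e[OF F])
    have "cinner p x = (\<Sum>n\<in>F. cinner x (e n) * cnj (cinner x (e n)))"
      unfolding p_def cinner_sum_left
      by (intro sum.cong refl) (metis cinner_commute cinner_scaleC_left)
    also have "\<dots> = complex_of_real ((norm p)\<^sup>2)"
      unfolding p2 of_real_sum by (intro sum.cong refl) (rule complex_norm_square[symmetric])
    finally have "(norm p)\<^sup>2 \<le> norm p * norm x"
      using norm_cinner_le[of p x] by (simp add: norm_power)
    then have "norm p \<le> norm x"
      by (cases "norm p = 0") (auto simp: power2_eq_square)
    then show "(\<Sum>n\<in>F. (norm (cinner x (e n)))\<^sup>2) \<le> (norm x)\<^sup>2"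
      unfolding p2[symmetric] by (rule power_mono) simp
  qed
qed simp

lemma expansion: "((\<lambda>n. cinner x (e n) *\<^sub>C e n) has_sum x) I"
proof -
  obtain y where y: "((\<lambda>n. cinner x (e n) *\<^sub>C e n) has_sum y) I"
    using riesz_fischer_has_sum[OF bessel] .
  have "y = x"
    by (rule eq_by_coordinates) (rule coordinate_of_has_sum[OF y])
  then show ?thesis
    using y by simp
qed

lemma parseval: "((\<lambda>n. cinner x (e n) * cnj (cinner y (e n))) has_sum cinner x y) I"
proof -
  have "((\<lambda>n. cinner (cinner x (e n) *\<^sub>C e n) y) has_sum cinner x y) I"
    by (rule has_sum_bounded_linear[OF bounded_linear_cinner_left expansion])
  moreover have "cinner (c *\<^sub>C e n) y = c * cnj (cinner y (e n))" for c n
    by (metis cinner_commute cinner_scaleC_left)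
  ultimately show ?thesis
    by simp
qed

end

section \<open>The spectral theorem for compact selfadjoint operators\<close>

lemma selfadjoint_inner:
  assumes "selfadjoint A"
  shows "inner (A x) y = inner x (A y)"
  using assms by (simp add: selfadjoint_def inner_eq_Re_cinner)

text \<open>
  If \<open>N\<close> is the norm of \<open>A\<close> on \<open>M\<close>, then \<open>N\<^sup>2\<close> is an approximate eigenvalue of \<open>A\<^sup>2\<close>, hence by
  compactness an eigenvalue; factoring \<open>A\<^sup>2 - N\<^sup>2 = (A - N) (A + N)\<close> gives an eigenvector of \<open>A\<close>.
\<close>
lemma selfadjoint_compact_eigenvector:
  fixes A :: "'a::complex_hilbert_space \<Rightarrow> 'a"
  assumes A: "compact_operator A" and sa: "selfadjoint A"
    and M: "closed M" "subspace M" "\<And>x. x \<in> M \<Longrightarrow> A x \<in> M" and x0: "x0 \<in> M" "x0 \<noteq> 0"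
  obtains x r where "x \<in> M" "x \<noteq> 0" "A x = complex_of_real r *\<^sub>C x"
proof (cases "\<forall>x\<in>M. A x = 0")
  case True
  then show thesis
    using that[of x0 0] x0 by (simp add: complex_vector.scale_zero_left)
next
  case False
  then obtain x1 where x1: "x1 \<in> M" "A x1 \<noteq> 0"
    by blast
  note lin = bounded_clinearD[OF compact_operator_imp_bounded_clinear[OF A]]
  interpret bounded_linear A by (rule lin(1))
  define S where "S = {x \<in> M. norm x = 1}"
  define N where "N = (SUP x\<in>S. norm (A x))"
  obtain K where K: "\<And>x. norm (A x) \<le> norm x * K"
    using pos_bounded by blast
  have bdd: "bdd_above ((\<lambda>x. norm (A x)) ` S)"
    using K[of _] by (intro bdd_aboveI2[of _ _ K]) (auto simp: S_def, metis mult_1)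
  have AN1: "norm (A x) \<le> N" if "x \<in> S" for x
    unfolding N_def by (rule cSUP_upper[OF that bdd])
  have AN: "norm (A x) \<le> N * norm x" if "x \<in> M" for x
  proof (cases "x = 0")
    case False
    then have "(1 / norm x) *\<^sub>R x \<in> S"
      using that M by (auto simp: S_def subspace_scale)
    then have "norm (A x) / norm x \<le> N"
      using AN1 by (fastforce simp: scaleR)
    then show ?thesis
      using False by (simp add: field_simps)
  qed (simp add: zero)
  have x1S: "x1 \<noteq> 0"
    using x1 zero by auto
  then have "(1 / norm x1) *\<^sub>R x1 \<in> S"
    using x1 M by (auto simp: S_def subspace_scale)
  then have Sne: "S \<noteq> {}"
    by blast
  have "0 < norm (A x1)"
    using x1 by simp
  also have "\<dots> \<le> N * norm x1"
    by (rule AN[OF x1(1)])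
  finally have N0: "N > 0"
    by (simp add: zero_less_mult_iff)
  have "\<exists>x\<in>S. N - inverse (real (Suc k)) < norm (A x)" for k
    using less_cSUP_iff[OF Sne bdd, of "N - inverse (real (Suc k))"] by (simp add: N_def[symmetric])
  then obtain x where xS: "\<And>k. x k \<in> S" and xN: "\<And>k. N - inverse (real (Suc k)) < norm (A (x k))"
    by metis
  have approx: "(norm (A (A u) - N\<^sup>2 *\<^sub>R u))\<^sup>2 \<le> N\<^sup>2 * (N\<^sup>2 - (norm (A u))\<^sup>2)" if "u \<in> S" for u
  proof -
    have u: "u \<in> M" "norm u = 1"
      using that by (auto simp: S_def)
    have "(norm (A (A u) - N\<^sup>2 *\<^sub>R u))\<^sup>2
        = (norm (A (A u)))\<^sup>2 - 2 * N\<^sup>2 * inner (A (A u)) u + N\<^sup>2 * N\<^sup>2 * (norm u)\<^sup>2"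
      by (simp add: power2_norm_eq_inner inner_diff_left inner_diff_right inner_commute)
    also have "inner (A (A u)) u = (norm (A u))\<^sup>2"
      by (simp add: selfadjoint_inner[OF sa, of "A u"] power2_norm_eq_inner)
    also have "(norm (A (A u)))\<^sup>2 \<le> (N * norm (A u))\<^sup>2"
      using AN[OF M(3)[OF u(1)]] by (rule power_mono) simp
    finally show ?thesis
      using u by (simp add: power_mult_distrib algebra_simps)
  qed
  have "(\<lambda>k. norm (A (x k))) \<longlonglongrightarrow> N"
  proof (rule tendsto_sandwich)
    show "(\<lambda>k. N - inverse (real (Suc k))) \<longlonglongrightarrow> N"
      using tendsto_diff[OF tendsto_const LIMSEQ_inverse_real_of_nat, of N] by simp
    show "(\<lambda>k. N) \<longlonglongrightarrow> N" by simp
  qed (use xN AN1 xS in \<open>auto intro!: always_eventually less_imp_le\<close>)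
  then have "(\<lambda>k. N\<^sup>2 * (N\<^sup>2 - (norm (A (x k)))\<^sup>2)) \<longlonglongrightarrow> N\<^sup>2 * (N\<^sup>2 - N\<^sup>2)"
    by (intro tendsto_intros)
  then have up: "(\<lambda>k. N\<^sup>2 * (N\<^sup>2 - (norm (A (x k)))\<^sup>2)) \<longlonglongrightarrow> 0"
    by simp
  have "(\<lambda>k. (norm (A (A (x k)) - N\<^sup>2 *\<^sub>R x k))\<^sup>2) \<longlonglongrightarrow> 0"
  proof (rule tendsto_sandwich)
    show "\<forall>\<^sub>F k in sequentially. 0 \<le> (norm (A (A (x k)) - N\<^sup>2 *\<^sub>R x k))\<^sup>2"
      by (rule always_eventually) simp
    show "\<forall>\<^sub>F k in sequentially. (norm (A (A (x k)) - N\<^sup>2 *\<^sub>R x k))\<^sup>2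
        \<le> N\<^sup>2 * (N\<^sup>2 - (norm (A (x k)))\<^sup>2)"
      by (rule always_eventually) (intro allI approx xS)
    show "(\<lambda>k. 0) \<longlonglongrightarrow> (0::real)"
      by (rule tendsto_const)
  qed (rule up)
  then have "(\<lambda>k. sqrt ((norm (A (A (x k)) - N\<^sup>2 *\<^sub>R x k))\<^sup>2)) \<longlonglongrightarrow> sqrt 0"
    by (rule tendsto_real_sqrt)
  then have lim0: "(\<lambda>k. A (A (x k)) - N\<^sup>2 *\<^sub>R x k) \<longlonglongrightarrow> 0"
    by (simp add: tendsto_norm_zero_iff)
  obtain w r where r: "strict_mono r" and w: "(\<lambda>k. A (x (r k))) \<longlonglongrightarrow> w"
    by (rule compact_operator_subseq[OF A, of x 1]) (use xS in \<open>auto simp: S_def\<close>)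
  have "(\<lambda>k. A (A (x (r k))) - (A (A (x (r k))) - N\<^sup>2 *\<^sub>R x (r k))) \<longlonglongrightarrow> A w - 0"
    using tendsto[OF w] LIMSEQ_subseq_LIMSEQ[OF lim0 r] by (intro tendsto_diff) (auto simp: o_def)
  then have lim: "(\<lambda>k. N\<^sup>2 *\<^sub>R x (r k)) \<longlonglongrightarrow> A w"
    by simp
  define y where "y = A w"
  have yM: "y \<in> M"
    unfolding y_def
    by (rule closed_sequentially[OF M(1) _ lim]) (use xS M in \<open>auto simp: S_def subspace_scale\<close>)
  have "norm y = N\<^sup>2"
    unfolding y_def using tendsto_norm[OF lim] xS N0 by (simp add: S_def LIMSEQ_const_iff)
  then have y0: "y \<noteq> 0"
    using N0 by auto
  have "(\<lambda>k. A (A (N\<^sup>2 *\<^sub>R x (r k)))) \<longlonglongrightarrow> A (A y)"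
    unfolding y_def by (intro tendsto lim)
  moreover have "(\<lambda>k. A (A (N\<^sup>2 *\<^sub>R x (r k)))) \<longlonglongrightarrow> N\<^sup>2 *\<^sub>R y"
    unfolding scaleR y_def by (intro tendsto_scaleR tendsto_const tendsto w)
  ultimately have AAy: "A (A y) = N\<^sup>2 *\<^sub>R y"
    by (rule LIMSEQ_unique)
  show thesis
  proof (cases "A y + N *\<^sub>R y = 0")
    case True
    then have "A y = complex_of_real (- N) *\<^sub>C y"
      by (simp add: scaleR_scaleC[symmetric] eq_neg_iff_add_eq_0 del: of_real_minus)
    then show thesis
      using that yM y0 by blast
  next
    case False
    have "A (A y + N *\<^sub>R y) = complex_of_real N *\<^sub>C (A y + N *\<^sub>R y)"
      by (simp add: scaleR_scaleC[symmetric] add scaleR AAy power2_eq_square algebra_simps)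
    moreover have "A y + N *\<^sub>R y \<in> M"
      using yM M by (intro subspace_add subspace_scale) auto
    ultimately show thesis
      using that False by blast
  qed
qed

lemma eigenvectors_orthogonal:
  assumes "selfadjoint A" "A x = complex_of_real r *\<^sub>C x" "A y = complex_of_real t *\<^sub>C y" "r \<noteq> t"
  shows "cinner x y = 0"
proof -
  have "complex_of_real r * cinner x y = complex_of_real t * cinner x y"
    using assms(1) unfolding selfadjoint_def
    by (metis assms(2,3) cinner_scaleC_left cinner_scaleC_right complex_cnj_complex_of_real)
  then show ?thesis
    using assms(4) by auto
qed

lemma dim_one_span:
  fixes V :: "'a::complex_vector set"
  assumes "complex_vector.dim V = 1" "v \<in> V" "v \<noteq> 0" "x \<in> V"
  obtains c where "x = c *\<^sub>C v"
proof -
  obtain B where B: "V \<subseteq> complex_vector.span B" "card B = 1"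
    using complex_vector.basis_exists[of V] assms(1) by metis
  then obtain b where b: "V \<subseteq> complex_vector.span {b}"
    by (auto simp: card_1_singleton_iff)
  then have "v \<in> range (\<lambda>k. k *\<^sub>C b)" "x \<in> range (\<lambda>k. k *\<^sub>C b)"
    using assms(2,4) by (auto simp: complex_vector.span_singleton)
  then obtain k l where kl: "x = k *\<^sub>C b" "v = l *\<^sub>C b"
    by blast
  then have "l \<noteq> 0"
    using assms(3) by (auto simp: complex_vector.scale_zero_left)
  then have "x = (k / l) *\<^sub>C v"
    using kl by (simp add: scaleC_scaleC)
  then show thesis ..
qed

text \<open>
  The vectors orthogonal to all \<open>e n\<close> form a closed invariant subspace. If it were not zero, it
  would contain an eigenvector of \<open>A\<close>, which by simplicity is a multiple of some \<open>e n\<close>.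
\<close>
lemma selfadjoint_compact_eigenbasis:
  fixes I :: "'i set" and s :: "'i \<Rightarrow> real" and A :: "'a::complex_hilbert_space \<Rightarrow> 'a"
  assumes inj: "inj_on s I" and s0: "\<forall>n\<in>I. s n \<noteq> 0"
    and A: "compact_operator A" and sa: "selfadjoint A"
    and ps: "point_spectrum A = (\<lambda>n. complex_of_real (s n)) ` I"
    and simple: "simple_point_spectrum A"
  obtains e where "orthonormal_basis I e" "\<And>n. n \<in> I \<Longrightarrow> A (e n) = complex_of_real (s n) *\<^sub>C e n"
proof -
  note lin = bounded_clinearD[OF compact_operator_imp_bounded_clinear[OF A]]
  have "\<exists>v. norm v = 1 \<and> A v = complex_of_real (s n) *\<^sub>C v" if n: "n \<in> I" for n
  proof -
    have "complex_of_real (s n) \<in> point_spectrum A"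
      using n ps by blast
    then obtain x where x: "x \<noteq> 0" "A x = complex_of_real (s n) *\<^sub>C x"
      by (auto simp: point_spectrum_def eigenspace_def)
    then have "norm (complex_of_real (1 / norm x) *\<^sub>C x) = 1"
      by (simp add: norm_scaleC norm_divide)
    moreover have "A (complex_of_real (1 / norm x) *\<^sub>C x)
        = complex_of_real (s n) *\<^sub>C complex_of_real (1 / norm x) *\<^sub>C x"
      by (simp add: lin x scaleC_scaleC)
    ultimately show ?thesis
      by blast
  qed
  then obtain e where norm_e: "\<And>n. n \<in> I \<Longrightarrow> norm (e n) = 1"
    and Ae: "\<And>n. n \<in> I \<Longrightarrow> A (e n) = complex_of_real (s n) *\<^sub>C e n"
    by metis
  define M where "M = {x. \<forall>n\<in>I. cinner x (e n) = 0}"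
  have "orthonormal_basis I e"
  proof
    show "cinner (e m) (e n) = 0" if "m \<in> I" "n \<in> I" "m \<noteq> n" for m n
      using eigenvectors_orthogonal[OF sa Ae Ae] that inj by (auto dest: inj_onD)
    fix x assume "\<And>n. n \<in> I \<Longrightarrow> cinner x (e n) = 0"
    then have xM: "x \<in> M"
      by (simp add: M_def)
    show "x = 0"
    proof (rule ccontr)
      assume x0: "x \<noteq> 0"
      have "closed (\<Inter>n\<in>I. {x. cinner x (e n) = 0})"
        by (intro closed_INT ballI closed_Collect_eq linear_continuous_on bounded_linear_cinner_left
            continuous_on_const)
      also have "(\<Inter>n\<in>I. {x. cinner x (e n) = 0}) = M"
        by (auto simp: M_def)
      finally have Mc: "closed M" .
      have Ms: "subspace M"
        by (auto simp: M_def subspace_def cinner_add_left cinner_scaleC_left scaleR_scaleC[where 'a = 'a])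
      have MA: "A u \<in> M" if "u \<in> M" for u
      proof -
        have "cinner (A u) (e n) = 0" if "n \<in> I" for n
          using sa \<open>u \<in> M\<close> that by (simp add: selfadjoint_def Ae cinner_scaleC_right M_def)
        then show ?thesis
          by (simp add: M_def)
      qed
      obtain v r where v: "v \<in> M" "v \<noteq> 0" "A v = complex_of_real r *\<^sub>C v"
        using selfadjoint_compact_eigenvector[OF A sa Mc Ms MA xM x0] .
      then have "complex_of_real r \<in> point_spectrum A"
        by (auto simp: point_spectrum_def eigenspace_def)
      then obtain n where n: "n \<in> I" "r = s n"
        using ps by auto
      have "complex_vector.dim (eigenspace A (complex_of_real (s n))) = 1"
        using simple ps n by (auto simp: simple_point_spectrum_def)
      moreover have "e n \<in> eigenspace A (complex_of_real (s n))"
        "v \<in> eigenspace A (complex_of_real (s n))" "e n \<noteq> 0"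
        using n v Ae norm_e[of n] by (auto simp: eigenspace_def)
      ultimately obtain c where c: "v = c *\<^sub>C e n"
        using dim_one_span by metis
      then have "cinner v (e n) = c"
        using norm_e n by (simp add: cinner_scaleC_left cinner_self)
      then have "c = 0"
        using v(1) n by (simp add: M_def)
      then show False
        using c v(2) by (simp add: complex_vector.scale_zero_left)
    qed
  qed (use norm_e in auto)
  then show thesis
    using that Ae by blast
qed

section \<open>Entire functions and the upper half-plane\<close>

text \<open>
  A bound that degenerates at the real axis does not hurt an entire function \<open>f\<close>: on the circle
  \<open>|\<zeta>| = R\<close> one has \<open>|\<zeta>\<^sup>2 - R\<^sup>2| = 2 R |Im \<zeta>|\<close>, so that \<open>f(\<zeta>) (\<zeta>\<^sup>2 - R\<^sup>2)\<^sup>m\<close> obeys a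
  uniform bound there, which the maximum principle carries to the inside.
\<close>
lemma growth_from_bound_off_real_axis:
  assumes hol: "f holomorphic_on UNIV"
    and bd: "\<And>z. norm (f z) * \<bar>Im z\<bar> ^ m \<le> C * (1 + norm z) ^ (m + k)"
  obtains B where "\<And>z. 1 \<le> norm z \<Longrightarrow> norm (f z) \<le> B * norm z ^ k"
proof
  fix z :: complex assume z: "1 \<le> norm z"
  have C: "C \<ge> 0"
    using order_trans[OF _ bd[of 0], of 0] by simp
  define R where "R = 2 * norm z"
  define h where "h = (\<lambda>\<zeta>. f \<zeta> * (\<zeta>\<^sup>2 - (complex_of_real R)\<^sup>2) ^ m)"
  have "norm (h z) \<le> (2 * R) ^ m * (C * (1 + R) ^ (m + k))"
  proof (rule maximum_modulus_frontier[where f = h and S = "cball 0 R" and \<xi> = z])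
    show "h holomorphic_on interior (cball 0 R)" "continuous_on (closure (cball 0 R)) h"
      unfolding h_def
      by (intro holomorphic_intros holomorphic_on_imp_continuous_on holomorphic_on_subset[OF hol]
          subset_UNIV)+
    show "z \<in> cball 0 R"
      by (simp add: R_def)
    fix \<zeta> :: complex assume "\<zeta> \<in> frontier (cball 0 R)"
    then have \<zeta>: "norm \<zeta> = R"
      using z by (simp add: frontier_cball R_def)
    have "\<zeta>\<^sup>2 - (complex_of_real R)\<^sup>2 = \<zeta> * (\<zeta> - cnj \<zeta>)"
      using complex_norm_square[of \<zeta>] by (simp add: \<zeta> power2_eq_square algebra_simps)
    also have "\<zeta> - cnj \<zeta> = 2 * \<i> * complex_of_real (Im \<zeta>)"
      by (simp add: complex_eq_iff)
    finally have "norm (\<zeta>\<^sup>2 - (complex_of_real R)\<^sup>2) = 2 * R * \<bar>Im \<zeta>\<bar>"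
      by (simp add: norm_mult \<zeta>)
    then have "norm (h \<zeta>) = (2 * R) ^ m * (norm (f \<zeta>) * \<bar>Im \<zeta>\<bar> ^ m)"
      by (simp add: h_def norm_mult norm_power power_mult_distrib)
    also have "\<dots> \<le> (2 * R) ^ m * (C * (1 + R) ^ (m + k))"
      using bd[of \<zeta>] by (intro mult_left_mono) (auto simp: \<zeta> R_def)
    finally show "norm (h \<zeta>) \<le> (2 * R) ^ m * (C * (1 + R) ^ (m + k))" .
  qed simp
  also have "2 * R = 4 * norm z"
    by (simp add: R_def)
  also have "(4 * norm z) ^ m * (C * (1 + R) ^ (m + k)) \<le> (4 * norm z) ^ m * (C * (3 * norm z) ^ (m + k))"
    using z C by (intro mult_left_mono power_mono) (auto simp: R_def)
  finally have 1: "norm (h z) \<le> (4 * norm z) ^ m * (C * (3 * norm z) ^ (m + k))" .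
  have "(norm z)\<^sup>2 \<le> norm ((complex_of_real R)\<^sup>2) - norm (z\<^sup>2)"
    by (simp add: R_def norm_power norm_mult power_mult_distrib)
  also have "\<dots> \<le> norm (z\<^sup>2 - (complex_of_real R)\<^sup>2)"
    by (subst norm_minus_commute) (rule norm_triangle_ineq2)
  finally have "norm (f z) * ((norm z)\<^sup>2) ^ m \<le> norm (h z)"
    unfolding h_def norm_mult norm_power by (intro mult_left_mono power_mono) auto
  with 1 have "norm (f z) * ((norm z)\<^sup>2) ^ m
      \<le> (C * 4 ^ m * 3 ^ (m + k) * norm z ^ k) * ((norm z)\<^sup>2) ^ m"
    by (simp add: power_mult_distrib power_add power2_eq_square algebra_simps)
  moreover have "((norm z)\<^sup>2) ^ m > 0"
    using z by (intro zero_less_power) auto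
  ultimately show "norm (f z) \<le> (C * 4 ^ m * 3 ^ (m + k)) * norm z ^ k"
    by (simp only: mult_le_cancel_right_pos)
qed

lemma entire_affine_if_linear_growth:
  fixes f :: "complex \<Rightarrow> complex"
  assumes "f holomorphic_on UNIV" and "\<And>z. 1 \<le> norm z \<Longrightarrow> norm (f z) \<le> B * norm z ^ 1"
  shows "f z = f 0 + deriv f 0 * z"
  using Liouville_polynomial[OF assms, where \<xi> = z] by simp

text \<open>
  Harnack's inequality for the positive harmonic function \<open>- ln |f|\<close>: the Schwarz lemma is applied
  to the logarithm of \<open>f\<close>, transplanted to the unit disc by the Cayley transform.
\<close>
lemma upper_half_plane_lower_bound:
  assumes hol: "f holomorphic_on {z. Im z > 0}"
    and nz: "\<And>z. Im z > 0 \<Longrightarrow> f z \<noteq> 0" and lt1: "\<And>z. Im z > 0 \<Longrightarrow> norm (f z) < 1"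
  obtains K where "\<And>z. Im z > 0 \<Longrightarrow> exp (- (K * (1 + norm z)\<^sup>2 / Im z)) \<le> norm (f z)"
proof -
  define c where "c = (\<lambda>w::complex. \<i> * (1 + w) / (1 - w))"
  have Imc: "Im (c w) > 0" if "norm w < 1" for w
  proof -
    have w1: "w \<noteq> 1"
      using that by auto
    have "Im (c w) = (1 - (norm w)\<^sup>2) / (norm (1 - w))\<^sup>2"
      using w1 unfolding c_def Im_divide cmod_power2
      by (simp add: power2_eq_square algebra_simps)
    then show ?thesis
      using that w1 by (simp add: power_less_one_iff abs_square_less_1)
  qed
  have "(\<lambda>w. f (c w)) holomorphic_on ball 0 1"
  proof (rule holomorphic_on_compose_gen[unfolded o_def, OF _ hol])
    show "c holomorphic_on ball 0 1"
      unfolding c_def by (intro holomorphic_intros) auto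
  qed (use Imc in auto)
  moreover have "contractible (ball (0::complex) 1)"
    by (simp add: convex_imp_contractible)
  ultimately obtain g where ghol: "g holomorphic_on ball 0 1"
    and g: "\<And>w. w \<in> ball 0 1 \<Longrightarrow> f (c w) = exp (g w)"
    using contractible_imp_holomorphic_log[of "\<lambda>w. f (c w)" "ball 0 1"] nz Imc by auto
  have Reg: "Re (g w) < 0" if "norm w < 1" for w
    using lt1[OF Imc[OF that]] g[of w] that by simp
  define b where "b = g 0"
  have Reb: "Re b < 0"
    unfolding b_def by (rule Reg) simp
  define h where "h = (\<lambda>w. (g w - b) / (g w + cnj b))"
  have den: "g w + cnj b \<noteq> 0" if "norm w < 1" for w
    using Reg[OF that] Reb by (auto simp: complex_eq_iff)
  have sq: "(norm (u + cnj b))\<^sup>2 - (norm (u - b))\<^sup>2 = 4 * Re u * Re b" for u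
    unfolding cmod_power2 by (simp add: power2_eq_square algebra_simps)
  have hlt: "norm (h w) < 1" if "norm w < 1" for w
  proof -
    have "0 < 4 * Re (g w) * Re b"
      using Reg[OF that] Reb by (simp add: mult_neg_neg)
    then have "(norm (g w - b))\<^sup>2 < (norm (g w + cnj b))\<^sup>2"
      using sq[of "g w"] by linarith
    then have "norm (g w - b) < norm (g w + cnj b)"
      by (rule power2_less_imp_less) simp
    then show ?thesis
      using den[OF that] by (simp add: h_def norm_divide)
  qed
  have hhol: "h holomorphic_on ball 0 1"
    unfolding h_def using den by (intro holomorphic_intros ghol) auto
  have schwarz: "norm (h w) \<le> norm w" if "norm w < 1" for w
    by (rule Schwarz_Lemma(1)[OF hhol _ hlt that]) (simp_all add: h_def b_def)
  have harnack: "- Re (g w) * (1 - norm w) \<le> - Re b * (1 + norm w)" if w: "norm w < 1" for w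
  proof -
    have "norm (g w - b) \<le> norm w * norm (g w + cnj b)"
      using schwarz[OF w] den[OF w] by (simp add: h_def norm_divide divide_le_eq)
    then have "(norm (g w - b))\<^sup>2 \<le> (norm w)\<^sup>2 * (norm (g w + cnj b))\<^sup>2"
      by (metis power_mono norm_ge_zero power_mult_distrib)
    then have "(Re (g w) - Re b)\<^sup>2 + (Im (g w) - Im b)\<^sup>2
        \<le> (norm w)\<^sup>2 * (Re (g w) + Re b)\<^sup>2 + (norm w)\<^sup>2 * (Im (g w) - Im b)\<^sup>2"
      by (simp add: cmod_power2 distrib_left)
    moreover have "(norm w)\<^sup>2 * (Im (g w) - Im b)\<^sup>2 \<le> 1 * (Im (g w) - Im b)\<^sup>2"
      using w by (intro mult_right_mono) (auto simp: power_le_one)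
    ultimately have "(Re (g w) - Re b)\<^sup>2 \<le> (norm w * (Re (g w) + Re b))\<^sup>2"
      by (simp add: power_mult_distrib)
    then have "\<bar>Re (g w) - Re b\<bar> \<le> \<bar>norm w * (Re (g w) + Re b)\<bar>"
      by (simp only: abs_le_square_iff)
    also have "\<dots> = - (norm w * (Re (g w) + Re b))"
      using Reg[OF w] Reb by (intro abs_of_nonpos mult_nonneg_nonpos) auto
    finally show ?thesis
      by (simp add: abs_le_iff algebra_simps)
  qed
  show thesis
  proof
    fix z :: complex assume z: "Im z > 0"
    define w where "w = (z - \<i>) / (z + \<i>)"
    have zi: "z + \<i> \<noteq> 0"
      using z by (auto simp: complex_eq_iff)
    have "1 - (norm w)\<^sup>2 = ((norm (z + \<i>))\<^sup>2 - (norm (z - \<i>))\<^sup>2) / (norm (z + \<i>))\<^sup>2"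
      using zi by (simp add: w_def norm_divide power_divide field_simps)
    also have "(norm (z + \<i>))\<^sup>2 - (norm (z - \<i>))\<^sup>2 = 4 * Im z"
      unfolding cmod_power2 by (simp add: power2_eq_square algebra_simps)
    finally have w2: "1 - (norm w)\<^sup>2 = 4 * Im z / (norm (z + \<i>))\<^sup>2" .
    also have "\<dots> > 0"
      using z zi by simp
    finally have w1: "norm w < 1"
      by (simp add: abs_square_less_1)
    have "c w = z"
    proof -
      have "1 - w = 2 * \<i> / (z + \<i>)" "1 + w = 2 * z / (z + \<i>)"
        using zi by (simp_all add: w_def field_simps)
      then show ?thesis
        using zi by (simp add: c_def)
    qed
    then have fz: "norm (f z) = exp (Re (g w))"
      using g[of w] w1 by simp
    have "- Re (g w) * (1 - (norm w)\<^sup>2) = - Re (g w) * (1 - norm w) * (1 + norm w)"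
      by (simp add: power2_eq_square algebra_simps)
    also have "\<dots> \<le> - Re b * (1 + norm w) * (1 + norm w)"
      using harnack[OF w1] by (intro mult_right_mono) auto
    also have "\<dots> \<le> - Re b * (2 * 2)"
      using w1 Reb unfolding mult.assoc by (intro mult_left_mono mult_mono) auto
    finally have "- Re (g w) * (4 * Im z) \<le> - Re b * 4 * (norm (z + \<i>))\<^sup>2"
      using zi by (simp add: w2 field_simps)
    also have "\<dots> \<le> - Re b * 4 * (1 + norm z)\<^sup>2"
      using Reb norm_triangle_ineq[of z \<i>] by (intro mult_left_mono power_mono) auto
    finally have "- Re (g w) \<le> - Re b * (1 + norm z)\<^sup>2 / Im z"
      using z by (simp add: pos_le_divide_eq pos_divide_le_eq)
    then show "exp (- (- Re b * (1 + norm z)\<^sup>2 / Im z)) \<le> norm (f z)"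
      unfolding fz by simp
  qed
qed

text \<open>
  The Borel-Caratheodory inequality for the derivative. With \<open>A = M - Re (g z)\<close> and \<open>G = g - g z\<close>, the
  map \<open>w \<mapsto> w / (2 A - w)\<close> sends the half-plane \<open>Re w < A\<close>, which contains the values of \<open>G\<close>, into
  the unit disc, and the Schwarz lemma applies to the composition.
\<close>
lemma deriv_bound_from_Re_bound:
  assumes hol: "g holomorphic_on ball z \<rho>" and \<rho>: "\<rho> > 0"
    and bd: "\<And>w. w \<in> ball z \<rho> \<Longrightarrow> Re (g w) < M"
  shows "norm (deriv g z) \<le> 2 * (M - Re (g z)) / \<rho>"
proof -
  define A where "A = M - Re (g z)"
  have A: "A > 0"
    using bd[of z] \<rho> by (simp add: A_def)
  define G where "G = (\<lambda>w::complex. g (z + \<rho> * w) - g z)"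
  have inb: "z + \<rho> * w \<in> ball z \<rho>" if "norm w < 1" for w :: complex
    using that \<rho> by (simp add: dist_norm norm_mult)
  have ReG: "Re (G w) < A" if "norm w < 1" for w
    using bd[OF inb[OF that]] by (simp add: G_def A_def)
  have Ghol: "G holomorphic_on ball 0 1"
    unfolding G_def
    by (intro holomorphic_intros holomorphic_on_compose_gen[unfolded o_def, OF _ hol]) (use inb in auto)
  define h where "h = (\<lambda>w. G w / (2 * A - G w))"
  have den: "2 * complex_of_real A - G w \<noteq> 0" if "norm w < 1" for w
    using ReG[OF that] A by (auto simp: complex_eq_iff)
  have hlt: "norm (h w) < 1" if "norm w < 1" for w
  proof -
    have "(norm (2 * complex_of_real A - G w))\<^sup>2 - (norm (G w))\<^sup>2 = 4 * A * (A - Re (G w))"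
      unfolding cmod_power2 by (simp add: power2_eq_square algebra_simps)
    also have "\<dots> > 0"
      using ReG[OF that] A by simp
    finally have "(norm (G w))\<^sup>2 < (norm (2 * complex_of_real A - G w))\<^sup>2"
      by simp
    then have "norm (G w) < norm (2 * complex_of_real A - G w)"
      by (rule power2_less_imp_less) simp
    then show ?thesis
      using den[OF that] by (simp add: h_def norm_divide)
  qed
  have hhol: "h holomorphic_on ball 0 1"
    unfolding h_def using den by (intro holomorphic_intros Ghol) auto
  have "norm (deriv h 0) \<le> 1"
    by (rule Schwarz_Lemma(2)[OF hhol _ hlt, of 0]) (simp_all add: h_def G_def)
  moreover have "(h has_field_derivative (\<rho> * deriv g z / (2 * A))) (at 0)"
  proof -
    have "(g has_field_derivative deriv g z) (at z)"
      using \<rho> by (intro holomorphic_derivI[OF hol]) auto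
    then have "(g has_field_derivative deriv g z) (at (z + \<rho> * 0))"
      by simp
    then have G': "(G has_field_derivative deriv g z * \<rho>) (at 0)"
      unfolding G_def by (auto intro!: derivative_eq_intros DERIV_chain2[where f = g])
    have "G 0 = 0"
      by (simp add: G_def)
    then show ?thesis
      unfolding h_def using A
      by (auto intro!: derivative_eq_intros G' simp: field_simps power2_eq_square)
  qed
  then have "deriv h 0 = \<rho> * deriv g z / (2 * A)"
    by (rule DERIV_imp_deriv)
  ultimately show ?thesis
    using A \<rho> by (simp add: norm_divide norm_mult A_def[symmetric] field_simps)
qed

lemma deriv_nonzero_at_simple_zero:
  fixes f :: "complex \<Rightarrow> complex"
  assumes hol: "f holomorphic_on UNIV" and "f w \<noteq> 0" "f z = 0" and ord: "zorder f z = 1"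
  shows "deriv f z \<noteq> 0"
proof -
  define g where "g = zor_poly f z"
  have "\<exists>r>0. g holomorphic_on cball z r \<and> (\<forall>u\<in>cball z r. f u = g u * (u - z) \<and> g u \<noteq> 0)"
    using zorder_exist_zero[OF hol open_UNIV connected_UNIV UNIV_I, of z] assms(2)
    unfolding g_def ord by auto
  then obtain r where r: "r > 0" and ghol: "g holomorphic_on cball z r"
    and fg: "\<And>u. u \<in> cball z r \<Longrightarrow> f u = g u * (u - z)" "\<And>u. u \<in> cball z r \<Longrightarrow> g u \<noteq> 0"
    by blast
  have "(g has_field_derivative deriv g z) (at z)"
    using r by (intro holomorphic_derivI[OF holomorphic_on_subset[OF ghol ball_subset_cball]]) auto
  then have "((\<lambda>u. g u * (u - z)) has_field_derivative g z) (at z)"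
    by (auto intro!: derivative_eq_intros)
  then have "(f has_field_derivative g z) (at z)"
    by (rule has_field_derivative_transform_within_open[of _ _ _ "ball z r"]) (use r fg in auto)
  then show ?thesis
    using fg(2)[of z] r by (simp add: DERIV_imp_deriv)
qed

section \<open>Cauchy series with poles at the reciprocals of a real null family\<close>

lemma has_sum_minus:
  fixes f g :: "'i \<Rightarrow> 'b::topological_ab_group_add"
  assumes "(f has_sum a) A" "(g has_sum b) A"
  shows "((\<lambda>x. f x - g x) has_sum (a - b)) A"
proof -
  have "((\<lambda>x. - g x) has_sum - b) A"
    using assms(2) by (simp add: has_sum_uminus)
  then show ?thesis
    using has_sum_add[OF assms(1)] by fastforce
qed

definition poles :: "('i \<Rightarrow> real) \<Rightarrow> 'i set \<Rightarrow> complex set" where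
  "poles s J = {z. \<exists>n\<in>J. s n * z = 1}"

text \<open>
  With \<open>t = 1 / s n\<close> the summand equals \<open>d n t\<^sup>2 (1 / (t - z) - 1 / t)\<close>, as in Krein's class. In
  terms of \<open>s n\<close> and \<open>d n\<close>, Krein's summability condition becomes absolute summability of \<open>d\<close>.
\<close>
definition cauchy_series :: "('i \<Rightarrow> real) \<Rightarrow> ('i \<Rightarrow> complex) \<Rightarrow> 'i set \<Rightarrow> complex \<Rightarrow> complex" where
  "cauchy_series s d J z = (\<Sum>\<^sub>\<infinity>n\<in>J. d n * (z / (1 - s n * z)))"

lemma poles_real: "z \<in> poles s J \<Longrightarrow> Im z = 0"
proof -
  assume "z \<in> poles s J"
  then obtain n where "s n * z = 1"
    by (auto simp: poles_def)
  then have "s n * Im z = 0" "s n \<noteq> 0"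
    by (auto simp: complex_eq_iff)
  then show ?thesis
    by simp
qed

lemma cnj_poles: "cnj z \<in> poles s J \<longleftrightarrow> z \<in> poles s J"
  by (metis poles_real complex_cnj_cnj complex_eq_iff complex_cnj cnj.simps minus_zero)

text \<open>
  This replaces the distance from \<open>z\<close> to the pole \<open>1 / t\<close> by the distance to the real axis,
  uniformly in \<open>t\<close>.
\<close>
lemma one_minus_real_mult_ge: "\<bar>Im z\<bar> \<le> norm (1 - complex_of_real t * z) * norm z"
proof -
  have "Im ((1 - complex_of_real t * z) * cnj z) = - Im z"
    by (simp add: algebra_simps)
  then show ?thesis
    by (metis abs_Im_le_cmod abs_minus_cancel norm_mult complex_mod_cnj)
qed

locale real_null_family =
  fixes I :: "'i set" and s :: "'i \<Rightarrow> real"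
  assumes inj: "inj_on s I" and nonzero: "n \<in> I \<Longrightarrow> s n \<noteq> 0"
    and fin: "\<epsilon> > 0 \<Longrightarrow> finite {n \<in> I. \<epsilon> \<le> \<bar>s n\<bar>}"
begin

lemma bounded_family:
  obtains S where "S > 0" "\<And>n. n \<in> I \<Longrightarrow> \<bar>s n\<bar> \<le> S"
proof
  define S where "S = Max (insert 1 ((\<lambda>n. \<bar>s n\<bar>) ` {n \<in> I. 1 \<le> \<bar>s n\<bar>}))"
  have S: "x \<le> S" if "x \<in> insert 1 ((\<lambda>n. \<bar>s n\<bar>) ` {n \<in> I. 1 \<le> \<bar>s n\<bar>})" for x
    unfolding S_def using that fin[of 1] by (intro Max_ge) auto
  show "S > 0"
    using S[of 1] by simp
  show "\<bar>s n\<bar> \<le> S" if "n \<in> I" for n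
    using S[of "\<bar>s n\<bar>"] S[of 1] that by (cases "1 \<le> \<bar>s n\<bar>") auto
qed

text \<open>
  Only finitely many \<open>s n\<close> satisfy \<open>2 |s n| (1 + |z|) \<ge> 1\<close>; for all others \<open>|1 - s n z| \<ge> 1/2\<close>.
\<close>
lemma away_from_poles_at:
  fixes z :: complex
  assumes J: "J \<subseteq> I" and z: "z \<notin> poles s J"
  obtains \<delta> where "\<delta> > 0" "\<And>n. n \<in> J \<Longrightarrow> \<delta> \<le> norm (1 - s n * z)"
proof
  define N where "N = {n \<in> J. 1 \<le> 2 * \<bar>s n\<bar> * (1 + norm z)}"
  have "N \<subseteq> {n \<in> I. 1 / (2 * (1 + norm z)) \<le> \<bar>s n\<bar>}"
    using J by (auto simp: N_def field_simps add_pos_nonneg)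
  moreover have "finite {n \<in> I. 1 / (2 * (1 + norm z)) \<le> \<bar>s n\<bar>}"
    by (rule fin) (simp add: add_pos_nonneg)
  ultimately have N: "finite N"
    by (rule finite_subset)
  define \<delta> where "\<delta> = Min (insert (1/2) ((\<lambda>n. norm (1 - s n * z)) ` N))"
  show "\<delta> > 0"
    unfolding \<delta>_def using N z by (subst Min_gr_iff) (auto simp: N_def poles_def)
  fix n assume n: "n \<in> J"
  show "\<delta> \<le> norm (1 - s n * z)"
  proof (cases "n \<in> N")
    case True
    then show ?thesis
      unfolding \<delta>_def using N by (intro Min_le) auto
  next
    case False
    have "2 * (\<bar>s n\<bar> * norm z) \<le> 2 * \<bar>s n\<bar> * (1 + norm z)"
      by (simp add: distrib_left)
    also have "\<dots> < 1"
      using False n by (simp add: N_def)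
    finally have "norm (s n * z) \<le> 1/2"
      by (simp add: norm_mult)
    then have "1/2 \<le> norm (1 - s n * z)"
      using norm_triangle_ineq2[of 1 "s n * z"] by simp
    moreover have "\<delta> \<le> 1/2"
      unfolding \<delta>_def using N by (intro Min_le) auto
    ultimately show ?thesis
      by simp
  qed
qed

lemma away_from_poles:
  fixes z :: complex
  assumes J: "J \<subseteq> I" and z: "z \<notin> poles s J"
  obtains r \<delta> where "r > 0" "\<delta> > 0"
    "\<And>(w::complex) n. w \<in> cball z r \<Longrightarrow> n \<in> J \<Longrightarrow> \<delta> \<le> norm (1 - s n * w)"
proof -
  obtain \<delta> where \<delta>: "\<delta> > 0" "\<And>n. n \<in> J \<Longrightarrow> \<delta> \<le> norm (1 - s n * z)"
    by (rule away_from_poles_at[OF J z]) (rule that)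
  obtain S where S: "S > 0" "\<And>n. n \<in> I \<Longrightarrow> \<bar>s n\<bar> \<le> S"
    by (rule bounded_family) (rule that)
  show thesis
  proof
    show "\<delta> / (2 * S) > 0" "\<delta> / 2 > 0"
      using \<delta> S by auto
    fix w n assume w: "w \<in> cball z (\<delta> / (2 * S))" and n: "n \<in> J"
    have "norm (s n * (w - z)) \<le> S * (\<delta> / (2 * S))"
      unfolding norm_mult norm_of_real using w n J S
      by (intro mult_mono) (auto simp: dist_norm norm_minus_commute)
    also have "\<dots> = \<delta> / 2"
      using S by simp
    finally have "norm (s n * (w - z)) \<le> \<delta> / 2" .
    moreover have "norm (1 - s n * z) - norm (s n * (w - z)) \<le> norm (1 - s n * z - s n * (w - z))"
      by (rule norm_triangle_ineq2)
    moreover have "1 - s n * z - s n * (w - z) = 1 - s n * w"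
      by (simp add: algebra_simps)
    ultimately show "\<delta> / 2 \<le> norm (1 - s n * w)"
      using \<delta>(2)[OF n] by simp
  qed
qed

lemma open_off_poles:
  assumes "J \<subseteq> I"
  shows "open (- poles s J)"
  unfolding open_contains_cball
proof
  fix z :: complex assume "z \<in> - poles s J"
  then obtain r \<delta> where "r > 0" "\<delta> > 0"
    "\<And>(w::complex) n. w \<in> cball z r \<Longrightarrow> n \<in> J \<Longrightarrow> \<delta> \<le> norm (1 - s n * w)"
    using away_from_poles[OF assms, of z] by auto
  then show "\<exists>r>0. cball z r \<subseteq> - poles s J"
    by (intro exI[of _ r]) (fastforce simp: poles_def)
qed

lemma term_bound:
  fixes w :: complex
  assumes "\<delta> > 0" "\<delta> \<le> norm (1 - s n * w)"
  shows "norm (d n * (w / (1 - s n * w))) \<le> norm (d n) * (norm w / \<delta>)"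
  unfolding norm_mult norm_divide using assms
  by (intro mult_left_mono divide_left_mono) (auto intro!: mult_pos_pos)

lemma cauchy_series_summable:
  fixes d :: "'i \<Rightarrow> complex" and z :: complex
  assumes J: "J \<subseteq> I" and d: "(\<lambda>n. norm (d n)) summable_on J" and z: "z \<notin> poles s J"
  shows "(\<lambda>n. d n * (z / (1 - s n * z))) summable_on J"
proof -
  obtain \<delta> where \<delta>: "\<delta> > 0" "\<And>n. n \<in> J \<Longrightarrow> \<delta> \<le> norm (1 - s n * z)"
    by (rule away_from_poles_at[OF J z]) (rule that)
  have "(\<lambda>n. norm (d n * (z / (1 - s n * z)))) summable_on J"
    by (rule Infinite_Sum.abs_summable_on_comparison_test'[OF summable_on_cmult_left[OF d]])
      (rule term_bound[OF \<delta>])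
  then show ?thesis
    by (rule abs_summable_summable)
qed

lemma cauchy_series_has_sum:
  fixes d :: "'i \<Rightarrow> complex" and z :: complex
  assumes "J \<subseteq> I" "(\<lambda>n. norm (d n)) summable_on J" "z \<notin> poles s J"
  shows "((\<lambda>n. d n * (z / (1 - s n * z))) has_sum cauchy_series s d J z) J"
  unfolding cauchy_series_def by (rule has_sum_infsum[OF cauchy_series_summable[OF assms]])

lemma cauchy_series_holomorphic:
  fixes d :: "'i \<Rightarrow> complex"
  assumes J: "J \<subseteq> I" and d: "(\<lambda>n. norm (d n)) summable_on J"
  shows "cauchy_series s d J holomorphic_on - poles s J"
proof -
  have "\<exists>r>0. cauchy_series s d J holomorphic_on ball z r" if z: "z \<notin> poles s J" for z
  proof -
    obtain r \<delta> where r: "r > 0" and \<delta>: "\<delta> > 0"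
      "\<And>(w::complex) n. w \<in> cball z r \<Longrightarrow> n \<in> J \<Longrightarrow> \<delta> \<le> norm (1 - s n * w)"
      by (rule away_from_poles[OF J z]) (rule that)
    have ul: "uniform_limit (cball z r) (\<lambda>X w. \<Sum>n\<in>X. d n * (w / (1 - s n * w)))
        (cauchy_series s d J) (finite_subsets_at_top J)"
      unfolding cauchy_series_def
    proof (rule Weierstrass_m_test_general)
      fix n w assume n: "n \<in> J" and w: "w \<in> cball z r"
      have "norm (d n * (w / (1 - s n * w))) \<le> norm (d n) * (norm w / \<delta>)"
        by (rule term_bound[OF \<delta>(1) \<delta>(2)[OF w n]])
      also have "norm w \<le> norm z + r"
        using w norm_triangle_ineq2[of w z] by (simp add: dist_norm norm_minus_commute)
      then have "norm (d n) * (norm w / \<delta>) \<le> norm (d n) * ((norm z + r) / \<delta>)"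
        using \<delta> by (intro mult_left_mono divide_right_mono) auto
      finally show "norm (d n * (w / (1 - s n * w))) \<le> norm (d n) * ((norm z + r) / \<delta>)" .
    qed (rule summable_on_cmult_left[OF d])
    have "1 - s n * w \<noteq> 0" if "w \<in> cball z r" "n \<in> J" for w :: complex and n
      using \<delta>(2)[OF that] \<delta>(1) by (metis norm_zero not_le)
    then have "(\<lambda>w. \<Sum>n\<in>X. d n * (w / (1 - s n * w))) holomorphic_on cball z r" if "X \<subseteq> J" for X
      using that by (intro holomorphic_intros) auto
    then have "\<forall>\<^sub>F X in finite_subsets_at_top J.
        continuous_on (cball z r) (\<lambda>w. \<Sum>n\<in>X. d n * (w / (1 - s n * w))) \<and>
        (\<lambda>w. \<Sum>n\<in>X. d n * (w / (1 - s n * w))) holomorphic_on ball z r"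
      by (intro eventually_finite_subsets_at_top_weakI conjI holomorphic_on_imp_continuous_on)
        (auto intro: holomorphic_on_subset[OF _ ball_subset_cball])
    then have "cauchy_series s d J holomorphic_on ball z r"
      using holomorphic_uniform_limit[OF _ ul] by auto
    then show ?thesis
      using r by blast
  qed
  then have "cauchy_series s d J analytic_on - poles s J"
    by (auto simp: analytic_on_def)
  then show ?thesis
    by (rule analytic_imp_holomorphic)
qed

lemma cauchy_series_split:
  fixes d :: "'i \<Rightarrow> complex" and z :: complex
  assumes J: "J \<subseteq> I" and d: "(\<lambda>n. norm (d n)) summable_on J" and z: "z \<notin> poles s J" and m: "m \<in> J"
  shows "cauchy_series s d J z = d m * (z / (1 - s m * z)) + cauchy_series s d (J - {m}) z"
proof -
  have "(\<lambda>n. d n * (z / (1 - s n * z))) summable_on (J - {m})"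
    by (rule summable_on_subset_banach[OF cauchy_series_summable[OF J d z]]) auto
  then have "infsum (\<lambda>n. d n * (z / (1 - s n * z))) (insert m (J - {m}))
      = d m * (z / (1 - s m * z)) + cauchy_series s d (J - {m}) z"
    unfolding cauchy_series_def by (rule infsum_insert) auto
  then show ?thesis
    using m by (simp add: cauchy_series_def insert_absorb)
qed

lemma cauchy_series_norm_le:
  fixes d :: "'i \<Rightarrow> complex" and z :: complex
  assumes J: "J \<subseteq> I" and d: "(\<lambda>n. norm (d n)) summable_on J" and z: "Im z \<noteq> 0"
  shows "norm (cauchy_series s d J z) \<le> (\<Sum>\<^sub>\<infinity>n\<in>J. norm (d n)) * ((norm z)\<^sup>2 / \<bar>Im z\<bar>)"
proof (rule norm_infsum_le)
  have z0: "norm z > 0"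
    using z by auto
  show "((\<lambda>n. d n * (z / (1 - s n * z))) has_sum cauchy_series s d J z) J"
    by (rule cauchy_series_has_sum[OF J d]) (use z poles_real in blast)
  show "((\<lambda>n. norm (d n) * ((norm z)\<^sup>2 / \<bar>Im z\<bar>)) has_sum
      (\<Sum>\<^sub>\<infinity>n\<in>J. norm (d n)) * ((norm z)\<^sup>2 / \<bar>Im z\<bar>)) J"
    by (intro has_sum_cmult_left has_sum_infsum d)
  fix n assume "n \<in> J"
  have "\<bar>Im z\<bar> / norm z \<le> norm (1 - s n * z)"
    using one_minus_real_mult_ge[of z "s n"] z0 by (simp add: divide_le_eq)
  then have "norm (d n * (z / (1 - s n * z))) \<le> norm (d n) * (norm z / (\<bar>Im z\<bar> / norm z))"
    using z z0 by (intro term_bound) auto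
  then show "norm (d n * (z / (1 - s n * z))) \<le> norm (d n) * ((norm z)\<^sup>2 / \<bar>Im z\<bar>)"
    by (simp add: power2_eq_square)
qed

lemma cnj_cauchy_series: "cnj (cauchy_series s d J (cnj z)) = cauchy_series s (\<lambda>n. cnj (d n)) J z"
  unfolding cauchy_series_def infsum_cnj[symmetric] by simp

lemma cauchy_series_Im_nonneg:
  fixes w :: "'i \<Rightarrow> real"
  assumes J: "J \<subseteq> I" and w: "(\<lambda>n. norm (w n)) summable_on J" "\<And>n. n \<in> J \<Longrightarrow> w n \<ge> 0" and z: "Im z > 0"
  shows "Im (cauchy_series s (\<lambda>n. complex_of_real (w n)) J z) \<ge> 0"
proof -
  have "((\<lambda>n. complex_of_real (w n) * (z / (1 - s n * z)))
      has_sum cauchy_series s (\<lambda>n. complex_of_real (w n)) J z) J"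
    by (rule cauchy_series_has_sum[OF J]) (use w(1) z poles_real in fastforce)+
  then have "((\<lambda>n. Im (complex_of_real (w n) * (z / (1 - s n * z))))
      has_sum Im (cauchy_series s (\<lambda>n. complex_of_real (w n)) J z)) J"
    by (rule has_sum_Im)
  then show ?thesis
  proof (rule has_sum_nonneg)
    fix n assume n: "n \<in> J"
    have "Im (z / (1 - s n * z)) = Im z / (norm (1 - s n * z))\<^sup>2"
      unfolding Im_divide cmod_power2 by (simp add: algebra_simps)
    moreover have "Im (complex_of_real (w n) * x) = w n * Im x" for x
      by simp
    ultimately show "Im (complex_of_real (w n) * (z / (1 - s n * z))) \<ge> 0"
      using w(2)[OF n] z by (simp only:) simp
  qed
qed

text \<open>Dominated convergence: each term tends to zero and is bounded by \<open>|d n|\<close>.\<close>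
lemma cauchy_series_imaginary_axis:
  fixes d :: "'i \<Rightarrow> complex"
  assumes J: "J \<subseteq> I" and d: "(\<lambda>n. norm (d n)) summable_on J"
  shows "((\<lambda>y. cauchy_series s d J (\<i> * complex_of_real y) / complex_of_real y) \<longlongrightarrow> 0) at_top"
proof (rule swap_uniform_limit'[where F = "finite_subsets_at_top J" and S = "{0<..}"])
  define t where "t = (\<lambda>n y. d n * (\<i> / (1 - s n * (\<i> * complex_of_real y))))"
  have ge1: "1 \<le> norm (1 - s n * (\<i> * complex_of_real y))" for n y
  proof -
    have "\<bar>Re (1 - s n * (\<i> * complex_of_real y))\<bar> \<le> norm (1 - s n * (\<i> * complex_of_real y))"
      by (rule abs_Re_le_cmod)
    then show ?thesis
      by simp
  qed
  show "uniform_limit {0<..} (\<lambda>X y. \<Sum>n\<in>X. t n y)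
      (\<lambda>y. cauchy_series s d J (\<i> * complex_of_real y) / complex_of_real y) (finite_subsets_at_top J)"
  proof (rule Weierstrass_m_test_general')
    fix n and y :: real
    have "norm (d n) / norm (1 - s n * (\<i> * complex_of_real y)) \<le> norm (d n) / 1"
      using ge1[of n y] by (intro divide_left_mono) auto
    then show "norm (t n y) \<le> norm (d n)"
      by (simp add: t_def norm_mult norm_divide)
  next
    fix y :: real assume y: "y \<in> {0<..}"
    have "\<i> * complex_of_real y \<notin> poles s J"
      using y poles_real by fastforce
    then have "((\<lambda>n. d n * (\<i> * complex_of_real y / (1 - s n * (\<i> * complex_of_real y))) * (1 / complex_of_real y))
        has_sum cauchy_series s d J (\<i> * complex_of_real y) * (1 / complex_of_real y)) J"
      by (intro has_sum_cmult_left cauchy_series_has_sum[OF J d])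
    then show "((\<lambda>n. t n y) has_sum cauchy_series s d J (\<i> * complex_of_real y) / complex_of_real y) J"
      using y by (simp add: t_def mult.assoc)
  qed (use d in simp)
  show "\<forall>\<^sub>F X in finite_subsets_at_top J. ((\<lambda>y. \<Sum>n\<in>X. t n y) \<longlongrightarrow> 0) at_top"
  proof (rule eventually_finite_subsets_at_top_weakI)
    fix X assume X: "finite X" "X \<subseteq> J"
    have "((\<lambda>y. t n y) \<longlongrightarrow> 0) at_top" if n: "n \<in> X" for n
    proof -
      have sn: "s n \<noteq> 0"
        using n X J nonzero by blast
      have "((\<lambda>y. norm (d n) * (inverse \<bar>s n\<bar> * inverse y)) \<longlongrightarrow> norm (d n) * (inverse \<bar>s n\<bar> * 0)) at_top"
        by (intro tendsto_intros tendsto_inverse_0_at_top filterlim_ident)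
      then have "((\<lambda>y. norm (d n) * (inverse \<bar>s n\<bar> * inverse y)) \<longlongrightarrow> 0) at_top"
        by simp
      then show ?thesis
      proof (rule Lim_null_comparison[rotated])
        show "\<forall>\<^sub>F y in at_top. norm (t n y) \<le> norm (d n) * (inverse \<bar>s n\<bar> * inverse y)"
        proof (rule eventually_mono[OF eventually_gt_at_top[of 0]])
          fix y :: real assume y: "y > 0"
          have "\<bar>s n\<bar> * y \<le> norm (1 - s n * (\<i> * complex_of_real y))"
            using abs_Im_le_cmod[of "1 - s n * (\<i> * complex_of_real y)"] y by (simp add: abs_mult)
          then have "norm (d n) / norm (1 - s n * (\<i> * complex_of_real y)) \<le> norm (d n) / (\<bar>s n\<bar> * y)"
            using y sn by (intro frac_le) auto
          then show "norm (t n y) \<le> norm (d n) * (inverse \<bar>s n\<bar> * inverse y)"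
            by (simp add: t_def norm_mult norm_divide divide_inverse norm_inverse)
        qed
      qed
    qed
    then show "((\<lambda>y. \<Sum>n\<in>X. t n y) \<longlongrightarrow> 0) at_top"
      using tendsto_sum[of X "\<lambda>n y. t n y" "\<lambda>_. 0"] by simp
  qed
qed (auto intro: eventually_gt_at_top)

text \<open>
  In the upper half-plane \<open>\<Sum> d n z / (1 - s n z)\<close> is a combination of three functions \<open>M\<close> of
  nonnegative imaginary part, one for each of the weights \<open>|d| + Re d\<close>, \<open>|d|\<close> and \<open>|d| + Im d\<close>.
  Since \<open>|M + \<i>| \<ge> max 1 |M|\<close>, dividing \<open>\<phi> = 1 - \<Sum> d n z / (1 - s n z)\<close> by six times the
  product of the \<open>M + \<i>\<close> gives a zero-free function bounded by one, to which Harnack's inequality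
  applies.
\<close>
lemma cauchy_series_lower_bound:
  fixes d :: "'i \<Rightarrow> complex"
  assumes d: "(\<lambda>n. norm (d n)) summable_on I" and nz: "\<And>z. Im z > 0 \<Longrightarrow> cauchy_series s d I z \<noteq> 1"
  obtains K where "\<And>z. Im z > 0 \<Longrightarrow>
    exp (- (K * (1 + norm z)\<^sup>2 / Im z)) \<le> norm (1 - cauchy_series s d I z)"
proof -
  define w1 w2 w3 where "w1 = (\<lambda>n. norm (d n) + Re (d n))" and "w2 = (\<lambda>n. norm (d n))"
    and "w3 = (\<lambda>n. norm (d n) + Im (d n))"
  have w0: "w1 n \<ge> 0" "w2 n \<ge> 0" "w3 n \<ge> 0" for n
    using abs_Re_le_cmod[of "d n"] abs_Im_le_cmod[of "d n"] by (auto simp: w1_def w2_def w3_def)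
  have dom: "(\<lambda>n. 2 * norm (d n)) summable_on I"
    using d by (rule summable_on_cmult_right)
  have dom': "(\<lambda>n. norm (w n)) summable_on I" if "\<And>n. \<bar>w n\<bar> \<le> 2 * norm (d n)" for w :: "'i \<Rightarrow> real"
    by (rule Infinite_Sum.abs_summable_on_comparison_test'[OF dom]) (use that in simp)
  have wb: "\<bar>w1 n\<bar> \<le> 2 * norm (d n)" "\<bar>w2 n\<bar> \<le> 2 * norm (d n)" "\<bar>w3 n\<bar> \<le> 2 * norm (d n)" for n
    unfolding w1_def w2_def w3_def
    using abs_Re_le_cmod[of "d n"] abs_Im_le_cmod[of "d n"] norm_ge_zero[of "d n"] by linarith+
  have ws: "(\<lambda>n. norm (w1 n)) summable_on I" "(\<lambda>n. norm (w2 n)) summable_on I"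
    "(\<lambda>n. norm (w3 n)) summable_on I"
    by (intro dom' wb)+
  define M where "M = (\<lambda>w z. cauchy_series s (\<lambda>n. complex_of_real (w n)) I z)"
  have sub: "{z. Im z > 0} \<subseteq> - poles s I"
    using poles_real by fastforce
  have Mhol: "M w holomorphic_on {z. Im z > 0}" if "(\<lambda>n. norm (w n)) summable_on I" for w
    unfolding M_def
    by (rule holomorphic_on_subset[OF cauchy_series_holomorphic sub]) (use that in auto)
  have MIm: "Im (M w z) \<ge> 0" if "(\<lambda>n. norm (w n)) summable_on I" "\<And>n. w n \<ge> 0" "Im z > 0" for w z
    unfolding M_def by (rule cauchy_series_Im_nonneg) (use that in auto)
  have Mi: "1 \<le> norm (M w z + \<i>) \<and> norm (M w z) \<le> norm (M w z + \<i>)"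
    if "(\<lambda>n. norm (w n)) summable_on I" "\<And>n. w n \<ge> 0" "Im z > 0" for w z
  proof
    have Im: "Im (M w z) \<ge> 0"
      by (rule MIm[OF that])
    then show "1 \<le> norm (M w z + \<i>)"
      using abs_Im_le_cmod[of "M w z + \<i>"] by simp
    have "(norm (M w z))\<^sup>2 \<le> (norm (M w z + \<i>))\<^sup>2"
      unfolding cmod_power2 using Im by (simp add: power2_eq_square algebra_simps)
    then show "norm (M w z) \<le> norm (M w z + \<i>)"
      by (rule power2_le_imp_le) simp
  qed
  define B where "B = (\<lambda>z. (M w1 z + \<i>) * (M w2 z + \<i>) * (M w3 z + \<i>))"
  define \<phi> where "\<phi> = (\<lambda>z. 1 - cauchy_series s d I z)"
  have \<phi>eq: "\<phi> z = 1 - ((M w1 z - M w2 z) + \<i> * (M w3 z - M w2 z))" if z: "Im z > 0" for z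
  proof -
    have "z \<notin> poles s I"
      using z sub by auto
    then have hs: "((\<lambda>n. complex_of_real (w n) * (z / (1 - s n * z))) has_sum M w z) I"
      if "(\<lambda>n. norm (w n)) summable_on I" for w
      unfolding M_def by (intro cauchy_series_has_sum) (use that in auto)
    have "((\<lambda>n. (complex_of_real (w1 n) * (z / (1 - s n * z)) - complex_of_real (w2 n) * (z / (1 - s n * z)))
        + \<i> * (complex_of_real (w3 n) * (z / (1 - s n * z)) - complex_of_real (w2 n) * (z / (1 - s n * z))))
        has_sum ((M w1 z - M w2 z) + \<i> * (M w3 z - M w2 z))) I"
      by (intro has_sum_add has_sum_minus has_sum_cmult_right hs ws)
    moreover have "(complex_of_real (w1 n) * x - complex_of_real (w2 n) * x)
        + \<i> * (complex_of_real (w3 n) * x - complex_of_real (w2 n) * x) = d n * x" for n x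
    proof -
      have "d n = (complex_of_real (w1 n) - complex_of_real (w2 n))
          + \<i> * (complex_of_real (w3 n) - complex_of_real (w2 n))"
        by (simp add: complex_eq_iff w1_def w2_def w3_def)
      then have "d n * x = ((complex_of_real (w1 n) - complex_of_real (w2 n))
          + \<i> * (complex_of_real (w3 n) - complex_of_real (w2 n))) * x"
        by (rule arg_cong)
      then show ?thesis
        by (simp only: ring_distribs left_diff_distrib right_diff_distrib mult.assoc)
    qed
    ultimately have "((\<lambda>n. d n * (z / (1 - s n * z)))
        has_sum ((M w1 z - M w2 z) + \<i> * (M w3 z - M w2 z))) I"
      by (simp only:)
    then show ?thesis
      unfolding \<phi>_def cauchy_series_def by (simp add: infsumI)
  qed
  have B1: "1 \<le> norm (B z)" and \<phi>B: "norm (\<phi> z) < norm (6 * B z)" if z: "Im z > 0" for z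
  proof -
    define x1 x2 x3 where "x1 = norm (M w1 z + \<i>)" and "x2 = norm (M w2 z + \<i>)" and "x3 = norm (M w3 z + \<i>)"
    have x: "1 \<le> x1" "1 \<le> x2" "1 \<le> x3"
      and Mx: "norm (M w1 z) \<le> x1" "norm (M w2 z) \<le> x2" "norm (M w3 z) \<le> x3"
      using Mi ws w0 z by (auto simp: x1_def x2_def x3_def)
    have nB: "norm (B z) = x1 * x2 * x3"
      by (simp add: B_def norm_mult x1_def x2_def x3_def)
    have "1 \<le> x1 * x2" "1 \<le> x2 * x3" "1 \<le> x1 * x3"
      using x mult_mono[of 1 x1 1 x2] mult_mono[of 1 x2 1 x3] mult_mono[of 1 x1 1 x3] by simp_all
    then have "1 * x1 \<le> (x2 * x3) * x1" "1 * x2 \<le> (x1 * x3) * x2" "1 * x3 \<le> (x1 * x2) * x3"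
      using x by (intro mult_right_mono; simp)+
    then have le: "x1 \<le> norm (B z)" "x2 \<le> norm (B z)" "x3 \<le> norm (B z)"
      by (simp_all add: nB mult_ac)
    then show "1 \<le> norm (B z)"
      using x by simp
    have "norm (\<phi> z) \<le> norm (1::complex) + norm ((M w1 z - M w2 z) + \<i> * (M w3 z - M w2 z))"
      unfolding \<phi>eq[OF z] by (rule norm_triangle_ineq4)
    also have "norm ((M w1 z - M w2 z) + \<i> * (M w3 z - M w2 z))
        \<le> norm (M w1 z - M w2 z) + norm (M w3 z - M w2 z)"
      using norm_triangle_ineq[of "M w1 z - M w2 z" "\<i> * (M w3 z - M w2 z)"] by (simp add: norm_mult)
    also have "norm (M w1 z - M w2 z) \<le> x1 + x2"
      using norm_triangle_ineq4[of "M w1 z" "M w2 z"] Mx by simp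
    also have "norm (M w3 z - M w2 z) \<le> x3 + x2"
      using norm_triangle_ineq4[of "M w3 z" "M w2 z"] Mx by simp
    finally show "norm (\<phi> z) < norm (6 * B z)"
      using le x by (simp add: norm_mult)
  qed
  have "\<exists>K. \<forall>z. Im z > 0 \<longrightarrow> exp (- (K * (1 + norm z)\<^sup>2 / Im z)) \<le> norm (\<phi> z / (6 * B z))"
  proof -
    have "B holomorphic_on {z. Im z > 0}"
      unfolding B_def by (intro holomorphic_intros Mhol ws)
    moreover have "6 * B z \<noteq> 0" if "z \<in> {z. Im z > 0}" for z
      using B1[of z] that by auto
    ultimately have "(\<lambda>z. \<phi> z / (6 * B z)) holomorphic_on {z. Im z > 0}"
      unfolding \<phi>_def
      by (intro holomorphic_intros holomorphic_on_subset[OF cauchy_series_holomorphic[OF order_refl d] sub])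
    moreover have "\<phi> z / (6 * B z) \<noteq> 0" if "Im z > 0" for z
      using nz[OF that] B1[OF that] by (auto simp: \<phi>_def)
    moreover have "norm (\<phi> z / (6 * B z)) < 1" if "Im z > 0" for z
      unfolding norm_divide using \<phi>B[OF that]
      by (subst divide_less_eq_1_pos) (auto intro: le_less_trans[OF norm_ge_zero])
    ultimately show ?thesis
      using upper_half_plane_lower_bound[of "\<lambda>z. \<phi> z / (6 * B z)"] by blast
  qed
  then obtain K where K: "\<And>z. Im z > 0 \<Longrightarrow>
      exp (- (K * (1 + norm z)\<^sup>2 / Im z)) \<le> norm (\<phi> z / (6 * B z))"
    by blast
  show thesis
  proof
    fix z assume z: "Im z > 0"
    note K[OF z]
    also have "norm (\<phi> z / (6 * B z)) \<le> norm (\<phi> z) / 1"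
      unfolding norm_divide using B1[OF z]
      by (intro divide_left_mono) (auto simp: norm_mult)
    finally show "exp (- (K * (1 + norm z)\<^sup>2 / Im z)) \<le> norm (1 - cauchy_series s d I z)"
      by (simp add: \<phi>_def)
  qed
qed

end

section \<open>Removing the poles\<close>

lemma zero_notin_poles [simp]: "0 \<notin> poles s J"
  by (simp add: poles_def)

context real_null_family
begin

lemma poles_image: "poles s I = (\<lambda>n. complex_of_real (inverse (s n))) ` I"
  using nonzero by (auto simp: poles_def image_iff field_simps)

lemma pole_eq_iff:
  assumes "m \<in> I"
  shows "complex_of_real (s m) * z = 1 \<longleftrightarrow> z = complex_of_real (inverse (s m))"
  using nonzero[OF assms] by (auto simp: field_simps)

lemma poles_remove:
  assumes m: "m \<in> I"
  shows "- poles s (I - {m}) = insert (complex_of_real (inverse (s m))) (- poles s I)"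
proof -
  have "complex_of_real (s n) * complex_of_real (inverse (s m)) = 1 \<Longrightarrow> n = m" if "n \<in> I" for n
  proof -
    assume "complex_of_real (s n) * complex_of_real (inverse (s m)) = 1"
    then have "complex_of_real (s n * inverse (s m)) = 1"
      by simp
    then have "s n = s m"
      unfolding of_real_eq_1_iff using nonzero[OF m] by (simp add: field_simps)
    then show "n = m"
      using inj that m by (auto dest: inj_onD)
  qed
  then show ?thesis
    using pole_eq_iff[OF m] m by (auto simp: poles_def)
qed

text \<open>
  Each pole together with the complement of all poles is an open set, so that a function given on
  these sets by formulas which agree off the poles is entire.
\<close>
lemma glue_at_poles:
  assumes h: "h holomorphic_on - poles s I"
    and k: "\<And>m. m \<in> I \<Longrightarrow> k m holomorphic_on - poles s (I - {m})"
    and eq: "\<And>m z. m \<in> I \<Longrightarrow> z \<notin> poles s I \<Longrightarrow> k m z = h z"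
  obtains H where "H holomorphic_on UNIV" "\<And>z. z \<notin> poles s I \<Longrightarrow> H z = h z"
    "\<And>m. m \<in> I \<Longrightarrow> H (complex_of_real (inverse (s m))) = k m (complex_of_real (inverse (s m)))"
proof -
  define idx where "idx z = (SOME n. n \<in> I \<and> z = complex_of_real (inverse (s n)))" for z
  have idx: "idx (complex_of_real (inverse (s m))) = m" if m: "m \<in> I" for m
  proof -
    define t where "t = complex_of_real (inverse (s m))"
    have "idx t \<in> I \<and> t = complex_of_real (inverse (s (idx t)))"
      unfolding idx_def by (rule someI[of _ m]) (use m in \<open>simp add: t_def\<close>)
    then show ?thesis
      using inj m by (auto simp: t_def dest: inj_onD)
  qed
  define H where "H z = (if z \<in> poles s I then k (idx z) z else h z)" for z
  have off: "H z = h z" if "z \<notin> poles s I" for z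
    using that by (simp add: H_def)
  have at: "H (complex_of_real (inverse (s m))) = k m (complex_of_real (inverse (s m)))" if "m \<in> I" for m
    using that idx by (auto simp: H_def poles_image)
  have Hk: "H holomorphic_on - poles s (I - {m})" if m: "m \<in> I" for m
    by (rule holomorphic_transform[OF k[OF m]])
      (use m eq off at in \<open>auto simp: poles_remove simp del: of_real_inverse\<close>)
  have "H analytic_on UNIV"
  proof -
    have "\<exists>U. open U \<and> z \<in> U \<and> H holomorphic_on U" for z
    proof (cases "z \<in> poles s I")
      case False
      then show ?thesis
        using open_off_poles[OF order_refl] holomorphic_transform[OF h, of H] off
        by (intro exI[of _ "- poles s I"]) auto
    next
      case True
      then obtain m where m: "m \<in> I" and z: "z = complex_of_real (inverse (s m))"
        by (auto simp: poles_image)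
      have "z \<in> - poles s (I - {m})"
        unfolding poles_remove[OF m] z by (rule insertI1)
      then show ?thesis
        by (intro exI[of _ "- poles s (I - {m})"] conjI open_off_poles Hk[OF m]) auto
    qed
    then show ?thesis
      by (subst analytic_on_analytic_at) (auto simp: analytic_at)
  qed
  then have "H holomorphic_on UNIV"
    by (rule analytic_imp_holomorphic)
  then show thesis
    using off at that by blast
qed

end

text \<open>
  These are the coefficients for which \<open>\<phi> = 1 - \<Sum> d n z / (1 - s n z)\<close> has no zeros, and a pole at
  every \<open>1 / s n\<close>; equivalently, \<open>1 / \<phi>\<close> is an entire function with simple zeros at
  the points \<open>1 / s n\<close>.
\<close>
locale zero_free_series = real_null_family +
  fixes d :: "'i \<Rightarrow> complex"
  assumes summable_d: "(\<lambda>n. norm (d n)) summable_on I"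
    and d_nonzero: "n \<in> I \<Longrightarrow> d n \<noteq> 0"
    and zero_free: "z \<notin> poles s I \<Longrightarrow> cauchy_series s d I z \<noteq> 1"
begin

definition phi :: "complex \<Rightarrow> complex" where
  "phi z = 1 - cauchy_series s d I z"

text \<open>The function \<open>(1 - s m z) \<phi>(z)\<close>, with the pole at \<open>1 / s m\<close> cancelled.\<close>
definition regular_part :: "'i \<Rightarrow> complex \<Rightarrow> complex" where
  "regular_part m z = (1 - complex_of_real (s m) * z) * (1 - cauchy_series s d (I - {m}) z) - d m * z"

lemma phi_0 [simp]: "phi 0 = 1"
  by (simp add: phi_def cauchy_series_def)

lemma phi_nonzero: "z \<notin> poles s I \<Longrightarrow> phi z \<noteq> 0"
  using zero_free by (simp add: phi_def)

lemma phi_holomorphic: "phi holomorphic_on - poles s I"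
  unfolding phi_def by (intro holomorphic_intros cauchy_series_holomorphic summable_d order_refl)

lemma summable_d_subset: "(\<lambda>n. norm (d n)) summable_on (I - {m})"
  by (rule summable_on_subset_banach[OF summable_d]) auto

lemma regular_part_holomorphic: "regular_part m holomorphic_on - poles s (I - {m})"
  unfolding regular_part_def
  by (intro holomorphic_intros cauchy_series_holomorphic summable_d_subset) auto

lemma regular_part_eq:
  assumes m: "m \<in> I" and z: "z \<notin> poles s I"
  shows "regular_part m z = (1 - complex_of_real (s m) * z) * phi z" "1 - complex_of_real (s m) * z \<noteq> 0"
proof -
  show nz: "1 - complex_of_real (s m) * z \<noteq> 0"
    using m z by (auto simp: poles_def)
  show "regular_part m z = (1 - complex_of_real (s m) * z) * phi z"
    unfolding regular_part_def phi_def cauchy_series_split[OF order_refl summable_d z m]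
    using nz by (simp add: field_simps)
qed

lemma regular_part_at_pole:
  assumes m: "m \<in> I"
  shows "regular_part m (complex_of_real (inverse (s m))) = - d m * complex_of_real (inverse (s m))"
  using nonzero[OF m] by (simp add: regular_part_def)

lemma regular_part_nonzero:
  assumes m: "m \<in> I" and z: "z \<in> - poles s (I - {m})"
  shows "regular_part m z \<noteq> 0"
proof (cases "z \<in> poles s I")
  case True
  then have "z = complex_of_real (inverse (s m))"
    using z poles_remove[OF m] by auto
  then show ?thesis
    using regular_part_at_pole[OF m] d_nonzero[OF m] nonzero[OF m] by simp
next
  case False
  then show ?thesis
    using regular_part_eq[OF m False] phi_nonzero by simp
qed

text \<open>Near \<open>1 / s m\<close> the function \<open>1 / \<phi>\<close> is \<open>(1 - s m z)\<close> divided by the regular part.\<close>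
lemma entire_reciprocal:
  obtains F where "F holomorphic_on UNIV" "\<And>z. F z = 0 \<longleftrightarrow> z \<in> poles s I"
    "\<And>z. z \<notin> poles s I \<Longrightarrow> F z = 1 / phi z"
    "\<And>m. m \<in> I \<Longrightarrow> (F has_field_derivative (s m)\<^sup>2 / d m) (at (complex_of_real (inverse (s m))))"
proof -
  define k where "k m z = (1 - complex_of_real (s m) * z) / regular_part m z" for m z
  have k_hol: "k m holomorphic_on - poles s (I - {m})" if "m \<in> I" for m
    unfolding k_def using regular_part_nonzero[OF that]
    by (intro holomorphic_intros regular_part_holomorphic) auto
  have k_eq: "k m z = 1 / phi z" if "m \<in> I" "z \<notin> poles s I" for m z
    using regular_part_eq[OF that] phi_nonzero[OF that(2)] by (simp add: k_def)
  obtain F where F: "F holomorphic_on UNIV" "\<And>z. z \<notin> poles s I \<Longrightarrow> F z = 1 / phi z"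
    "\<And>m. m \<in> I \<Longrightarrow> F (complex_of_real (inverse (s m))) = k m (complex_of_real (inverse (s m)))"
    by (rule glue_at_poles[of "\<lambda>z. 1 / phi z" k, OF _ k_hol k_eq])
      (use phi_nonzero phi_holomorphic in \<open>auto intro!: holomorphic_intros\<close>)
  have zero: "F z = 0 \<longleftrightarrow> z \<in> poles s I" for z
  proof
    assume "z \<in> poles s I"
    then obtain m where "m \<in> I" "z = complex_of_real (inverse (s m))"
      by (auto simp: poles_image)
    then show "F z = 0"
      using F(3) nonzero[of m] by (simp add: k_def)
  qed (use F(2) phi_nonzero in force)
  have "(F has_field_derivative (s m)\<^sup>2 / d m) (at (complex_of_real (inverse (s m))))"
    if m: "m \<in> I" for m
  proof -
    define t where "t = complex_of_real (inverse (s m))"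
    have tU: "t \<in> - poles s (I - {m})"
      unfolding poles_remove[OF m] t_def by blast
    have op: "open (- poles s (I - {m}))"
      by (rule open_off_poles) auto
    have s1: "complex_of_real (s m) * t = 1"
      using nonzero[OF m] by (simp add: t_def)
    have R: "(regular_part m has_field_derivative deriv (regular_part m) t) (at t)"
      by (rule holomorphic_derivI[OF regular_part_holomorphic op tU])
    have Rt: "regular_part m t = - d m * t" "regular_part m t \<noteq> 0"
      using regular_part_at_pole[OF m] regular_part_nonzero[OF m tU] by (auto simp: t_def)
    have "(k m has_field_derivative - complex_of_real (s m) / regular_part m t) (at t)"
      unfolding k_def using Rt(2) s1
      by (auto intro!: derivative_eq_intros R simp: field_simps)
    also have "- complex_of_real (s m) / regular_part m t = complex_of_real ((s m)\<^sup>2) / d m"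
      using nonzero[OF m] d_nonzero[OF m] unfolding Rt(1)
      by (simp add: t_def field_simps power2_eq_square)
    finally have "(k m has_field_derivative complex_of_real ((s m)\<^sup>2) / d m) (at t)" .
    then have "(F has_field_derivative complex_of_real ((s m)\<^sup>2) / d m) (at t)"
    proof (rule has_field_derivative_transform_within_open[OF _ op tU])
      fix z assume "z \<in> - poles s (I - {m})"
      then show "k m z = F z"
        using F(2) F(3)[OF m] k_eq[OF m] unfolding poles_remove[OF m] by auto
    qed
    then show ?thesis
      by (simp add: t_def)
  qed
  then show thesis
    using that F zero by blast
qed

lemma phi_norm_le:
  assumes "Im z \<noteq> 0"
  shows "norm (phi z) \<le> 1 + (\<Sum>\<^sub>\<infinity>n\<in>I. norm (d n)) * ((norm z)\<^sup>2 / \<bar>Im z\<bar>)"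
proof -
  have "norm (phi z) \<le> norm (1::complex) + norm (cauchy_series s d I z)"
    unfolding phi_def by (rule norm_triangle_ineq4)
  also have "norm (cauchy_series s d I z) \<le> (\<Sum>\<^sub>\<infinity>n\<in>I. norm (d n)) * ((norm z)\<^sup>2 / \<bar>Im z\<bar>)"
    by (rule cauchy_series_norm_le[OF order_refl summable_d assms])
  finally show ?thesis
    by simp
qed

lemma phi_imaginary_axis:
  "((\<lambda>y. norm (phi (\<i> * complex_of_real y)) / y) \<longlongrightarrow> 0) at_top"
proof -
  have "((\<lambda>y. inverse (complex_of_real y) - cauchy_series s d I (\<i> * complex_of_real y) / complex_of_real y)
      \<longlongrightarrow> 0 - 0) at_top"
  proof (intro tendsto_diff cauchy_series_imaginary_axis order_refl summable_d)
    have "((\<lambda>y::real. complex_of_real (inverse y)) \<longlongrightarrow> complex_of_real 0) at_top"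
      by (intro tendsto_of_real tendsto_inverse_0_at_top filterlim_ident)
    then show "((\<lambda>y. inverse (complex_of_real y)) \<longlongrightarrow> 0) at_top"
      by simp
  qed
  then have "((\<lambda>y. norm (inverse (complex_of_real y)
      - cauchy_series s d I (\<i> * complex_of_real y) / complex_of_real y)) \<longlongrightarrow> 0) at_top"
    by (intro tendsto_norm_zero) simp
  moreover have "\<forall>\<^sub>F y in at_top. norm (inverse (complex_of_real y)
      - cauchy_series s d I (\<i> * complex_of_real y) / complex_of_real y)
      = norm (phi (\<i> * complex_of_real y)) / y"
  proof (rule eventually_mono[OF eventually_gt_at_top[of 0]])
    fix y :: real assume y: "y > 0"
    have "inverse (complex_of_real y) - cauchy_series s d I (\<i> * complex_of_real y) / complex_of_real y
        = phi (\<i> * complex_of_real y) / complex_of_real y"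
      by (simp add: phi_def diff_divide_distrib inverse_eq_divide)
    then show "norm (inverse (complex_of_real y)
        - cauchy_series s d I (\<i> * complex_of_real y) / complex_of_real y)
        = norm (phi (\<i> * complex_of_real y)) / y"
      using y by (simp add: norm_divide)
  qed
  ultimately show ?thesis
    by (rule Lim_transform_eventually)
qed

lemma conjugate: "zero_free_series I s (\<lambda>n. cnj (d n))"
proof
  show "cauchy_series s (\<lambda>n. cnj (d n)) I z \<noteq> 1" if "z \<notin> poles s I" for z
    using zero_free[of "cnj z"] that cnj_poles[of z s I] by (simp add: cnj_cauchy_series[symmetric])
qed (use summable_d d_nonzero in auto)

text \<open>
  Both half-planes are covered by applying the lower bound to \<open>d\<close> and to its conjugate.
\<close>
lemma abs_ln_phi_le:
  obtains K where "K > 0" "\<And>z. Im z \<noteq> 0 \<Longrightarrow> \<bar>ln (norm (phi z))\<bar> \<le> K * (1 + norm z)\<^sup>2 / \<bar>Im z\<bar>"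
proof -
  interpret cj: zero_free_series I s "\<lambda>n. cnj (d n)"
    by (rule conjugate)
  define C where "C = (\<Sum>\<^sub>\<infinity>n\<in>I. norm (d n))"
  have C: "C \<ge> 0"
    unfolding C_def by (rule infsum_nonneg) simp
  have nz: "cauchy_series s d I z \<noteq> 1" "cauchy_series s (\<lambda>n. cnj (d n)) I z \<noteq> 1" if "Im z > 0" for z
    using that poles_real[of z s I] by (intro zero_free cj.zero_free; force)+
  obtain K1 where K1: "\<And>z. Im z > 0 \<Longrightarrow>
      exp (- (K1 * (1 + norm z)\<^sup>2 / Im z)) \<le> norm (1 - cauchy_series s d I z)"
    by (rule cauchy_series_lower_bound[OF summable_d nz(1)]) (assumption, rule that)
  obtain K2 where K2: "\<And>z. Im z > 0 \<Longrightarrow>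
      exp (- (K2 * (1 + norm z)\<^sup>2 / Im z)) \<le> norm (1 - cauchy_series s (\<lambda>n. cnj (d n)) I z)"
    by (rule cauchy_series_lower_bound[OF cj.summable_d nz(2)]) (assumption, rule that)
  define K where "K = 1 + C + \<bar>K1\<bar> + \<bar>K2\<bar>"
  show thesis
  proof
    show "K > 0"
      using C by (simp add: K_def)
    fix z :: complex assume z: "Im z \<noteq> 0"
    define Q where "Q = (1 + norm z)\<^sup>2 / \<bar>Im z\<bar>"
    have Q: "Q > 0"
      unfolding Q_def using z by (intro divide_pos_pos zero_less_power add_pos_nonneg) auto
    have pos: "norm (phi z) > 0"
      using phi_nonzero[of z] z poles_real[of z s I] by auto
    have "norm (phi z) \<le> 1 + C * ((norm z)\<^sup>2 / \<bar>Im z\<bar>)"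
      unfolding C_def by (rule phi_norm_le[OF z])
    also have "\<dots> \<le> 1 + C * Q"
      unfolding Q_def using C by (intro add_left_mono mult_left_mono divide_right_mono power_mono) auto
    also have "\<dots> \<le> exp (C * Q)"
      by (rule exp_ge_add_one_self)
    finally have "ln (norm (phi z)) \<le> ln (exp (C * Q))"
      using pos by (subst ln_le_cancel_iff) auto
    then have "ln (norm (phi z)) \<le> C * Q"
      by simp
    moreover have "\<exists>L. L \<le> \<bar>K1\<bar> + \<bar>K2\<bar> \<and> exp (- (L * Q)) \<le> norm (phi z)"
    proof (cases "Im z > 0")
      case True
      then show ?thesis
        using K1[OF True] by (intro exI[of _ K1]) (auto simp: Q_def phi_def)
    next
      case False
      then have "Im (cnj z) > 0"
        using z by simp
      from K2[OF this] have "exp (- (K2 * Q)) \<le> norm (phi z)"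
        using False z complex_mod_cnj[of "phi z"] cnj_cauchy_series[of d I "cnj z"]
        by (simp add: Q_def phi_def)
      then show ?thesis
        by (intro exI[of _ K2]) auto
    qed
    then obtain L where L: "L \<le> \<bar>K1\<bar> + \<bar>K2\<bar>" "exp (- (L * Q)) \<le> norm (phi z)"
      by blast
    then have "- (L * Q) \<le> ln (norm (phi z))"
      using pos by (simp add: ln_ge_iff)
    moreover have "L * Q \<le> (\<bar>K1\<bar> + \<bar>K2\<bar>) * Q"
      using L Q by (intro mult_right_mono) auto
    moreover have "0 \<le> C * Q" "0 \<le> \<bar>K1\<bar> * Q" "0 \<le> \<bar>K2\<bar> * Q"
      using C Q by auto
    ultimately have "\<bar>ln (norm (phi z))\<bar> \<le> K * Q"
      using Q unfolding K_def distrib_right abs_le_iff by (intro conjI; linarith)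
    then show "\<bar>ln (norm (phi z))\<bar> \<le> K * (1 + norm z)\<^sup>2 / \<bar>Im z\<bar>"
      by (simp add: Q_def)
  qed
qed

end

section \<open>The exponential factor\<close>

context zero_free_series
begin

lemma cnj_phi_cnj: "1 - cauchy_series s (\<lambda>n. cnj (d n)) I z = cnj (phi (cnj z))"
  by (simp add: phi_def cnj_cauchy_series[symmetric])

text \<open>
  The quotient of \<open>\<phi>\<close> by its reflection has neither zeros nor poles, so it is \<open>exp g\<close> with \<open>g\<close>
  entire. The bounds on \<open>ln |\<phi>|\<close> control \<open>Re g\<close> off the real axis, the Borel-Caratheodory inequality on
  discs of radius \<open>|Im z| / 2\<close> turns them into \<open>|g'(z)| \<le> C (1 + |z|)\<^sup>2 / |Im z|\<^sup>2\<close>, and such a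
  derivative is constant.
\<close>
lemma phi_reflection:
  obtains \<beta> where "Re \<beta> = 0" "\<And>z. z \<notin> poles s I \<Longrightarrow> phi z = exp (\<beta> * z) * cnj (phi (cnj z))"
proof -
  interpret cj: zero_free_series I s "\<lambda>n. cnj (d n)"
    by (rule conjugate)
  have cj_phi: "cj.phi z = cnj (phi (cnj z))" for z
    by (simp add: cj.phi_def cnj_phi_cnj)
  obtain \<psi> where \<psi>hol: "\<psi> holomorphic_on UNIV"
    and \<psi>off: "\<And>z. z \<notin> poles s I \<Longrightarrow> \<psi> z = phi z / cj.phi z"
    and \<psi>at: "\<And>m. m \<in> I \<Longrightarrow> \<psi> (complex_of_real (inverse (s m)))
      = regular_part m (complex_of_real (inverse (s m))) / cj.regular_part m (complex_of_real (inverse (s m)))"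
  proof (rule glue_at_poles[of "\<lambda>z. phi z / cj.phi z" "\<lambda>m z. regular_part m z / cj.regular_part m z"])
    show "(\<lambda>z. phi z / cj.phi z) holomorphic_on - poles s I"
      using cj.phi_nonzero by (intro holomorphic_intros phi_holomorphic cj.phi_holomorphic) auto
    show "(\<lambda>z. regular_part m z / cj.regular_part m z) holomorphic_on - poles s (I - {m})" if "m \<in> I" for m
      using cj.regular_part_nonzero[OF that]
      by (intro holomorphic_intros regular_part_holomorphic cj.regular_part_holomorphic) auto
    show "regular_part m z / cj.regular_part m z = phi z / cj.phi z" if "m \<in> I" "z \<notin> poles s I" for m z
      using regular_part_eq[OF that] cj.regular_part_eq[OF that] by simp
  qed (use that in blast)
  have \<psi>nz: "\<psi> z \<noteq> 0" for z
  proof (cases "z \<in> poles s I")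
    case True
    then obtain m where m: "m \<in> I" "z = complex_of_real (inverse (s m))"
      by (auto simp: poles_image)
    then have "z \<in> - poles s (I - {m})"
      by (simp only: poles_remove insertI1)
    then show ?thesis
      using regular_part_nonzero cj.regular_part_nonzero \<psi>at m by simp
  next
    case False
    then show ?thesis
      using \<psi>off phi_nonzero cj.phi_nonzero by simp
  qed
  obtain g0 where g0: "g0 holomorphic_on UNIV" "\<And>z. \<psi> z = exp (g0 z)"
    by (rule contractible_imp_holomorphic_log[OF \<psi>hol contractible_UNIV \<psi>nz]) auto
  define g where "g z = g0 z - g0 0" for z
  have ghol: "g holomorphic_on UNIV"
    unfolding g_def by (intro holomorphic_intros g0)
  have "\<psi> 0 = 1"
    by (simp add: \<psi>off cj_phi)
  then have g: "\<psi> z = exp (g z)" for z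
    using g0(2)[of z] g0(2)[of 0] by (simp add: g_def exp_diff)
  obtain K1 where K1: "K1 > 0" "\<And>z. Im z \<noteq> 0 \<Longrightarrow> \<bar>ln (norm (phi z))\<bar> \<le> K1 * (1 + norm z)\<^sup>2 / \<bar>Im z\<bar>"
    by (rule abs_ln_phi_le) (rule that)
  obtain K2 where K2: "K2 > 0" "\<And>z. Im z \<noteq> 0 \<Longrightarrow> \<bar>ln (norm (cj.phi z))\<bar> \<le> K2 * (1 + norm z)\<^sup>2 / \<bar>Im z\<bar>"
    by (rule cj.abs_ln_phi_le) (rule that)
  define L where "L = K1 + K2"
  have L: "L > 0"
    using K1 K2 by (simp add: L_def)
  have Reg: "\<bar>Re (g z)\<bar> \<le> L * (1 + norm z)\<^sup>2 / \<bar>Im z\<bar>" if z: "Im z \<noteq> 0" for z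
  proof -
    have zp: "z \<notin> poles s I"
      using z poles_real by blast
    have "exp (Re (g z)) = norm (phi z) / norm (cj.phi z)"
      unfolding norm_divide[symmetric] \<psi>off[OF zp, symmetric] g by simp
    then have "Re (g z) = ln (norm (phi z) / norm (cj.phi z))"
      by (metis ln_exp)
    also have "\<dots> = ln (norm (phi z)) - ln (norm (cj.phi z))"
      using phi_nonzero[OF zp] cj.phi_nonzero[OF zp] by (simp add: ln_div)
    finally show ?thesis
      using K1(2)[OF z] K2(2)[OF z] unfolding L_def distrib_right add_divide_distrib by linarith
  qed
  have g': "norm (deriv g z) * \<bar>Im z\<bar>\<^sup>2 \<le> (40 * L) * (1 + norm z) ^ (2 + 0)" for z
  proof (cases "Im z = 0")
    case True
    then show ?thesis
      using L by simp
  next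
    case False
    \<comment> \<open>On the disc of radius \<open>\<rho>\<close> the bound for \<open>Re g\<close> is at most \<open>8 Q\<close>; \<open>9 Q\<close> makes it strict.\<close>
    define \<rho> Q where "\<rho> = \<bar>Im z\<bar> / 2" and "Q = L * (1 + norm z)\<^sup>2 / \<bar>Im z\<bar>"
    have Q: "Q > 0"
      unfolding Q_def using False L by (intro divide_pos_pos mult_pos_pos zero_less_power add_pos_nonneg) auto
    have "norm (deriv g z) \<le> 2 * (9 * Q - Re (g z)) / \<rho>"
    proof (rule deriv_bound_from_Re_bound)
      show "g holomorphic_on ball z \<rho>"
        by (rule holomorphic_on_subset[OF ghol]) simp
      show "\<rho> > 0"
        using False by (simp add: \<rho>_def)
      fix w assume "w \<in> ball z \<rho>"
      then have w: "norm (w - z) < \<rho>"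
        by (simp add: dist_norm norm_minus_commute)
      have Imw: "\<bar>Im z\<bar> / 2 \<le> \<bar>Im w\<bar>"
        using abs_Im_le_cmod[of "w - z"] w by (simp add: \<rho>_def abs_if split: if_splits)
      have "norm w \<le> norm z + \<rho>"
        using norm_triangle_ineq2[of w z] w by simp
      also have "\<rho> \<le> norm z"
        using abs_Im_le_cmod[of z] by (simp add: \<rho>_def)
      finally have nw: "1 + norm w \<le> 2 * (1 + norm z)"
        by simp
      have "Re (g w) \<le> L * (1 + norm w)\<^sup>2 / \<bar>Im w\<bar>"
        using Reg[of w] Imw False by fastforce
      also have "\<dots> \<le> L * (2 * (1 + norm z))\<^sup>2 / (\<bar>Im z\<bar> / 2)"
        using Imw nw False L by (intro frac_le mult_left_mono power_mono mult_nonneg_nonneg) auto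
      also have "\<dots> = 8 * Q"
        by (simp only: Q_def power_mult_distrib) simp
      also have "\<dots> < 9 * Q"
        using Q by simp
      finally show "Re (g w) < 9 * Q" .
    qed
    also have "\<dots> \<le> 2 * (10 * Q) / \<rho>"
      using Reg[OF False] False by (intro divide_right_mono mult_left_mono) (auto simp: Q_def \<rho>_def)
    finally have "norm (deriv g z) * \<bar>Im z\<bar>\<^sup>2 \<le> 2 * (10 * Q) / \<rho> * \<bar>Im z\<bar>\<^sup>2"
      by (intro mult_right_mono) auto
    also have "\<dots> = (40 * L) * (1 + norm z) ^ (2 + 0)"
      using False by (simp add: Q_def \<rho>_def power2_eq_square)
    finally show ?thesis .
  qed
  have g'hol: "deriv g holomorphic_on UNIV"
    by (rule holomorphic_deriv[OF ghol]) simp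
  obtain B where B: "\<And>z. 1 \<le> norm z \<Longrightarrow> norm (deriv g z) \<le> B * norm z ^ 0"
    by (rule growth_from_bound_off_real_axis[OF g'hol g']) (rule that)
  define \<beta> where "\<beta> = deriv g 0"
  have g'\<beta>: "deriv g z = \<beta>" for z
    using Liouville_polynomial[OF g'hol B, where \<xi> = z] by (simp add: \<beta>_def)
  have "\<exists>c. \<forall>z\<in>UNIV. g z - \<beta> * z = c"
  proof (rule has_field_derivative_zero_constant)
    show "((\<lambda>z. g z - \<beta> * z) has_field_derivative 0) (at z within UNIV)" for z
      using holomorphic_derivI[OF ghol open_UNIV UNIV_I, of z] g'\<beta>[of z]
      by (auto intro!: derivative_eq_intros)
  qed simp
  then have g\<beta>: "g z = \<beta> * z" for z
    by (metis UNIV_I diff_add_cancel diff_self g_def mult_zero_right add_0)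
  have reflection: "phi z = exp (\<beta> * z) * cnj (phi (cnj z))" if "z \<notin> poles s I" for z
    using \<psi>off[OF that] g[of z] cj.phi_nonzero[OF that] by (simp add: g\<beta> cj_phi)
  have "open (- poles s I)"
    by (rule open_off_poles) simp
  then obtain r where r: "r > 0" "ball 0 r \<subseteq> - poles s I"
    by (meson ComplI open_contains_ball zero_notin_poles)
  define x where "x = complex_of_real (r / 2)"
  have xp: "x \<notin> poles s I"
    using r by (auto simp: x_def subset_iff)
  have "norm (phi x) = norm (exp (\<beta> * x)) * norm (phi x)"
    using arg_cong[OF reflection[OF xp], of norm] by (simp add: norm_mult x_def)
  then have "exp (Re (\<beta> * x)) = 1"
    using phi_nonzero[OF xp] by simp
  then have "Re \<beta> = 0"
    using r(1) by (simp add: x_def)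
  then show thesis
    using that reflection by blast
qed

section \<open>The function of Krein's class\<close>

text \<open>
  With \<open>\<beta>\<close> from the reflection formula, \<open>G = exp (\<beta> z / 2) / \<phi>\<close> equals its own reflection, so it is
  real. Its reciprocal satisfies \<open>|1 / G|\<^sup>2 = |\<phi>(z)| |\<phi>(cnj z)|\<close> and thus grows no faster than a Cauchy
  series; the difference between \<open>1 / G\<close> and the series formed with the principal parts of \<open>1 / G\<close>
  is then an entire function of at most linear growth, \<open>o(|z|)\<close> on the imaginary axis, and zero
  at the origin.
\<close>
theorem krein_function_with_zeros_at_poles:
  "\<exists>G\<in>krein_class. {z. G z = 0} = poles s I"
proof -
  interpret cj: zero_free_series I s "\<lambda>n. cnj (d n)"
    by (rule conjugate)
  have cj_phi: "cj.phi z = cnj (phi (cnj z))" for z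
    by (simp add: cj.phi_def cnj_phi_cnj)
  obtain \<beta> where \<beta>: "Re \<beta> = 0" "\<And>z. z \<notin> poles s I \<Longrightarrow> phi z = exp (\<beta> * z) * cnj (phi (cnj z))"
    by (rule phi_reflection) (rule that)
  have cnj\<beta>: "cnj \<beta> = - \<beta>"
    using \<beta>(1) by (simp add: complex_eq_iff)
  obtain F where F: "F holomorphic_on UNIV" "\<And>z. F z = 0 \<longleftrightarrow> z \<in> poles s I"
    "\<And>z. z \<notin> poles s I \<Longrightarrow> F z = 1 / phi z"
    and F': "\<And>m. m \<in> I \<Longrightarrow> (F has_field_derivative (s m)\<^sup>2 / d m) (at (complex_of_real (inverse (s m))))"
    by (rule entire_reciprocal) (rule that)
  define E where "E z = exp (\<beta> / 2 * z)" for z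
  have Ehol: "E holomorphic_on S" for S
    unfolding E_def by (intro holomorphic_intros)
  have E_nz: "E z \<noteq> 0" for z
    by (simp add: E_def)
  have E_sq: "exp (\<beta> * z) = E z * E z" for z
    by (simp add: E_def exp_add[symmetric] algebra_simps)
  have cnj_E: "cnj (E (cnj z)) = 1 / E z" for z
    by (simp add: E_def exp_cnj cnj\<beta> exp_minus inverse_eq_divide)
  define G where "G z = F z * E z" for z
  have Ghol: "G holomorphic_on UNIV"
    unfolding G_def by (intro holomorphic_intros F Ehol)
  have G0: "G z = 0 \<longleftrightarrow> z \<in> poles s I" for z
    using F(2) E_nz by (simp add: G_def)
  have Goff: "1 / G z = phi z / E z" if "z \<notin> poles s I" for z
    using F(3)[OF that] by (simp add: G_def)
  have G_refl: "cnj (G (cnj z)) = G z" for z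
  proof (cases "z \<in> poles s I")
    case True
    then show ?thesis
      using G0 cnj_poles by (metis complex_cnj_zero_iff)
  next
    case False
    then have "cnj z \<notin> poles s I"
      using cnj_poles by blast
    then have "cnj (G (cnj z)) = 1 / cnj (phi (cnj z)) * (1 / E z)"
      by (simp add: G_def F(3) cnj_E[symmetric])
    also have "\<dots> = E z / phi z"
      unfolding \<beta>(2)[OF False] E_sq using E_nz by simp
    finally show ?thesis
      by (simp add: G_def F(3)[OF False])
  qed
  define t where "t m = complex_of_real (inverse (s m))" for m
  have t: "t m \<noteq> 0" "complex_of_real (s m) * t m = 1" "t m \<in> poles s I" if "m \<in> I" for m
    using nonzero[OF that] that unfolding t_def poles_image by auto
  \<comment> \<open>Multiplying by the zero-free factor \<open>1 / E\<close> scales the principal part of \<open>\<phi>\<close> at \<open>t m\<close> by \<open>1 / E (t m)\<close>.\<close>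
  define d' where "d' m = d m / E (t m)" for m
  have G': "deriv G (t m) = (s m)\<^sup>2 / d' m" if "m \<in> I" for m
  proof -
    have "(E has_field_derivative deriv E (t m)) (at (t m))"
      by (rule holomorphic_derivI[OF Ehol open_UNIV UNIV_I])
    then have "(G has_field_derivative F (t m) * deriv E (t m) + (s m)\<^sup>2 / d m * E (t m)) (at (t m))"
      unfolding G_def using F'[OF that]
      by (auto intro!: derivative_eq_intros simp: t_def)
    then show ?thesis
      using F(2) t(3)[OF that] by (simp add: DERIV_imp_deriv d'_def)
  qed
  have norm_d': "norm (d' m) = norm (d m)" for m
    using \<beta>(1) by (simp add: d'_def E_def t_def norm_divide)
  have sum_d': "(\<lambda>m. norm (d' m)) summable_on J" if "J \<subseteq> I" for J
    unfolding norm_d' by (rule summable_on_subset_banach[OF summable_d that])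
  define h where "h z = phi z / E z - 1 + cauchy_series s d' I z" for z
  \<comment> \<open>Up to the remaining terms of the series, \<open>h\<close> is \<open>N m z / (1 - s m z)\<close> near \<open>t m\<close>, and \<open>N m\<close> vanishes there.\<close>
  define N where "N m z = regular_part m z / E z + d' m * z" for m z
  have Nhol: "N m holomorphic_on - poles s (I - {m})" for m
    unfolding N_def using E_nz by (intro holomorphic_intros Ehol regular_part_holomorphic) auto
  have Nt: "N m (t m) = 0" if "m \<in> I" for m
    using regular_part_at_pole[OF that] by (simp add: N_def d'_def t_def)
  define k where "k m z = (- t m) * (if z = t m then deriv (N m) (t m) else (N m z - N m (t m)) / (z - t m))
      - 1 + cauchy_series s d' (I - {m}) z" for m z
  obtain H where Hhol: "H holomorphic_on UNIV" and Hoff: "\<And>z. z \<notin> poles s I \<Longrightarrow> H z = h z"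
  proof (rule glue_at_poles[of h k])
    show "h holomorphic_on - poles s I"
      unfolding h_def using E_nz sum_d'
      by (intro holomorphic_intros phi_holomorphic Ehol cauchy_series_holomorphic) auto
    show "k m holomorphic_on - poles s (I - {m})" if "m \<in> I" for m
      unfolding k_def using sum_d'[of "I - {m}"]
      by (intro holomorphic_intros cauchy_series_holomorphic pole_lemma_open[OF Nhol] open_off_poles) auto
    show "k m z = h z" if m: "m \<in> I" and z: "z \<notin> poles s I" for m z
    proof -
      have zt: "z \<noteq> t m"
        using t(3)[OF m] z by blast
      have "(- t m) * (N m z / (z - t m)) = N m z / (1 - s m * z)"
      proof -
        have "1 - complex_of_real (s m) * z = - complex_of_real (s m) * (z - t m)"
          using t(2)[OF m] by (simp add: algebra_simps)
        moreover have "t m = 1 / complex_of_real (s m)"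
          by (simp add: t_def inverse_eq_divide)
        ultimately show ?thesis
          using zt nonzero[OF m] by simp
      qed
      also have "\<dots> = phi z / E z + d' m * (z / (1 - s m * z))"
        unfolding N_def regular_part_eq(1)[OF m z] using regular_part_eq(2)[OF m z]
        by (simp add: add_divide_distrib)
      finally show ?thesis
        using zt Nt[OF m] cauchy_series_split[OF order_refl sum_d'[OF order_refl] z m]
        by (simp add: k_def h_def)
    qed
  qed (use that in blast)
  define C where "C = (\<Sum>\<^sub>\<infinity>n\<in>I. norm (d n))"
  have C: "C \<ge> 0"
    unfolding C_def by (rule infsum_nonneg) simp
  have recip_sq: "(norm (phi z / E z))\<^sup>2 = norm (phi z) * norm (cj.phi z)" if "z \<notin> poles s I" for z
  proof -
    have "(phi z / E z)\<^sup>2 = phi z * cj.phi z"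
      using \<beta>(2)[OF that] E_nz[of z] by (simp add: cj_phi E_sq power2_eq_square field_simps)
    then show ?thesis
      by (metis norm_mult norm_power)
  qed
  have Hbd: "norm (H z) * \<bar>Im z\<bar> ^ 1 \<le> (2 + 2 * C) * (1 + norm z) ^ (1 + 1)" for z
  proof (cases "Im z = 0")
    case True
    then show ?thesis
      using C by simp
  next
    case False
    have zp: "z \<notin> poles s I"
      using False poles_real by blast
    define P where "P = 1 + C * ((norm z)\<^sup>2 / \<bar>Im z\<bar>)"
    have P0: "P \<ge> 0"
      using C by (simp add: P_def)
    have "norm (phi z) * norm (cj.phi z) \<le> P * P"
      using phi_norm_le[OF False] cj.phi_norm_le[OF False] P0 by (intro mult_mono) (auto simp: P_def C_def)
    then have "(norm (phi z / E z))\<^sup>2 \<le> P\<^sup>2"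
      unfolding recip_sq[OF zp] by (simp add: power2_eq_square)
    then have "norm (phi z / E z) \<le> P"
      using P0 by (rule power2_le_imp_le)
    moreover have "norm (cauchy_series s d' I z) \<le> C * ((norm z)\<^sup>2 / \<bar>Im z\<bar>)"
      using cauchy_series_norm_le[OF order_refl sum_d'[OF order_refl] False] by (simp add: norm_d' C_def)
    moreover have "norm (h z) \<le> norm (phi z / E z) + norm (1::complex) + norm (cauchy_series s d' I z)"
      unfolding h_def by (intro order_trans[OF norm_triangle_ineq] add_right_mono norm_triangle_ineq4)
    ultimately have "norm (H z) \<le> 2 + 2 * C * ((norm z)\<^sup>2 / \<bar>Im z\<bar>)"
      by (simp add: Hoff[OF zp] P_def)
    then have "norm (H z) * \<bar>Im z\<bar> \<le> (2 + 2 * C * ((norm z)\<^sup>2 / \<bar>Im z\<bar>)) * \<bar>Im z\<bar>"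
      by (intro mult_right_mono) auto
    also have "\<dots> = 2 * \<bar>Im z\<bar> + 2 * C * (norm z)\<^sup>2"
      using False by (simp add: distrib_right)
    also have "\<dots> \<le> 2 * (1 + norm z)\<^sup>2 + 2 * C * (1 + norm z)\<^sup>2"
    proof (intro add_mono mult_left_mono power_mono)
      have "\<bar>Im z\<bar> \<le> (1 + norm z) * 1"
        using abs_Im_le_cmod[of z] by simp
      also have "\<dots> \<le> (1 + norm z) * (1 + norm z)"
        by (intro mult_left_mono) auto
      finally show "\<bar>Im z\<bar> \<le> (1 + norm z)\<^sup>2"
        by (simp add: power2_eq_square)
    qed (use C in auto)
    finally show ?thesis
      by (simp add: distrib_right power2_eq_square)
  qed
  obtain B where B: "\<And>z. 1 \<le> norm z \<Longrightarrow> norm (H z) \<le> B * norm z ^ 1"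
    by (rule growth_from_bound_off_real_axis[OF Hhol Hbd]) (rule that)
  define \<gamma> where "\<gamma> = deriv H 0"
  have "h 0 = 0"
    by (simp add: h_def E_def cauchy_series_def)
  then have Hlin: "H z = \<gamma> * z" for z
    using entire_affine_if_linear_growth[OF Hhol B, of z] Hoff[of 0] by (simp add: \<gamma>_def)
  have "((\<lambda>y::real. norm \<gamma>) \<longlongrightarrow> 0) at_top"
  proof -
    let ?u = "\<lambda>y. norm (phi (\<i> * complex_of_real y)) / y + norm (cj.phi (\<i> * complex_of_real y)) / y
        + inverse y + norm (cauchy_series s d' I (\<i> * complex_of_real y) / complex_of_real y)"
    have "(?u \<longlongrightarrow> 0 + 0 + 0 + 0) at_top"
      by (intro tendsto_add phi_imaginary_axis cj.phi_imaginary_axis tendsto_norm_zero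
          cauchy_series_imaginary_axis order_refl sum_d' tendsto_inverse_0_at_top filterlim_ident)
    then have lim: "(?u \<longlongrightarrow> 0) at_top"
      by simp
    have "\<forall>\<^sub>F y in at_top. norm \<gamma> \<le> ?u y"
    proof (rule eventually_mono[OF eventually_gt_at_top[of 0]])
      fix y :: real assume y: "y > 0"
      define z where "z = \<i> * complex_of_real y"
      have zp: "z \<notin> poles s I"
        using poles_real[of z s I] y by (auto simp: z_def)
      have "(norm (phi z / E z))\<^sup>2 \<le> (norm (phi z) + norm (cj.phi z))\<^sup>2"
        unfolding recip_sq[OF zp] by (simp add: power2_sum)
      then have "norm (phi z / E z) \<le> norm (phi z) + norm (cj.phi z)"
        by (rule power2_le_imp_le) simp
      moreover have "norm (h z) \<le> norm (phi z / E z) + norm (1::complex) + norm (cauchy_series s d' I z)"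
        unfolding h_def by (intro order_trans[OF norm_triangle_ineq] add_right_mono norm_triangle_ineq4)
      moreover have "norm (h z) = norm \<gamma> * y"
        using Hoff[OF zp] Hlin[of z] y by (simp add: norm_mult z_def)
      ultimately have "norm \<gamma> * y \<le> norm (phi z) + norm (cj.phi z) + 1 + norm (cauchy_series s d' I z)"
        by simp
      then have "norm \<gamma> \<le> (norm (phi z) + norm (cj.phi z) + 1 + norm (cauchy_series s d' I z)) / y"
        using y by (simp add: pos_le_divide_eq)
      then show "norm \<gamma> \<le> ?u y"
        using y by (simp add: z_def[symmetric] add_divide_distrib norm_divide inverse_eq_divide)
    qed
    then show ?thesis
      by (intro tendsto_sandwich[OF _ _ tendsto_const lim]) simp_all
  qed
  then have "\<gamma> = 0"
    by (simp add: tendsto_const_iff)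
  then have recip: "1 / G z = 1 - cauchy_series s d' I z" if "z \<notin> poles s I" for z
    using Hlin[of z] Hoff[OF that] Goff[OF that] by (simp add: h_def algebra_simps)
  have bij: "bij_betw t I (poles s I)"
    unfolding bij_betw_def t_def poles_image using inj by (auto simp: inj_on_def)
  have c_eq: "(- 1 / deriv G (t m)) / (t m)\<^sup>2 = - d' m" if "m \<in> I" for m
    using G'[OF that] nonzero[OF that] by (simp add: t_def power2_eq_square field_simps)
  have term_eq: "(- 1 / deriv G (t m)) * (1 / (t m - z) - 1 / t m) = - (d' m * (z / (1 - s m * z)))"
    if m: "m \<in> I" and z: "z \<notin> poles s I" for m and z :: complex
  proof -
    have zt: "t m - z \<noteq> 0"
      using t(3)[OF m] z by auto
    have "1 / (t m - z) - 1 / t m = z / (t m * (t m - z))"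
      using zt t(1)[OF m] by (simp add: field_simps)
    also have "t m * (t m - z) = (t m)\<^sup>2 * (1 - s m * z)"
      using t(2)[OF m] by (simp add: power2_eq_square algebra_simps)
    finally have "(- 1 / deriv G (t m)) * (1 / (t m - z) - 1 / t m)
        = (- 1 / deriv G (t m)) / (t m)\<^sup>2 * (z / (1 - s m * z))"
      by simp
    then show ?thesis
      unfolding c_eq[OF m] by simp
  qed
  have "G \<in> krein_class"
    unfolding krein_class_def mem_Collect_eq Let_def
  proof (intro conjI allI impI)
    show "G holomorphic_on UNIV" "G 0 \<noteq> 0"
      using Ghol G0 by auto
    show "G (complex_of_real x) \<in> \<real>" for x
      using G_refl[of "complex_of_real x"] by (simp add: Reals_cnj_iff)
    show "z \<in> \<real>" if "G z = 0" for z
      using that G0 poles_real by (auto simp: complex_is_Real_iff)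
    show "zorder G z = 1" if Gz: "G z = 0" for z
    proof -
      have "z \<in> t ` I"
        using Gz G0 bij by (simp add: bij_betw_def)
      then obtain m where m: "m \<in> I" "z = t m"
        by blast
      have "deriv G z \<noteq> 0"
        using G'[OF m(1)] nonzero[OF m(1)] d_nonzero[OF m(1)] E_nz m(2) by (simp add: d'_def)
      then show ?thesis
        by (intro zorder_zero_eqI[OF Ghol open_UNIV UNIV_I]) (auto simp: Gz)
    qed
    show "(\<lambda>t. norm (- 1 / deriv G t) / (norm t)\<^sup>2) summable_on {t. G t = 0}"
    proof -
      have "norm (- 1 / deriv G (t m)) / (norm (t m))\<^sup>2 = norm (d m)" if "m \<in> I" for m
        using arg_cong[OF c_eq[OF that], of norm] by (simp only: norm_divide norm_power norm_minus_cancel norm_d')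
      then have "(\<lambda>m. norm (- 1 / deriv G (t m)) / (norm (t m))\<^sup>2) summable_on I"
        using summable_d by (simp cong: summable_on_cong)
      then show ?thesis
        using summable_on_reindex_bij_betw[OF bij, of "\<lambda>t. norm (- 1 / deriv G t) / (norm t)\<^sup>2"] G0 by simp
    qed
    fix z assume "G z \<noteq> 0"
    then have z: "z \<notin> poles s I"
      using G0 by simp
    have "((\<lambda>m. - (d' m * (z / (1 - s m * z)))) has_sum - cauchy_series s d' I z) I"
      by (intro has_sum_uminusI cauchy_series_has_sum order_refl sum_d' z)
    then have "((\<lambda>m. (- 1 / deriv G (t m)) * (1 / (t m - z) - 1 / t m)) has_sum - cauchy_series s d' I z) I"
      using term_eq[OF _ z] by (simp cong: has_sum_cong)
    then have "((\<lambda>t. (- 1 / deriv G t) * (1 / (t - z) - 1 / t)) has_sum - cauchy_series s d' I z) {t. G t = 0}"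
      using has_sum_reindex_bij_betw[OF bij, of "\<lambda>t. (- 1 / deriv G t) * (1 / (t - z) - 1 / t)"] G0 by simp
    moreover have "1 / G z = 1 / G 0 + - cauchy_series s d' I z"
      using recip[OF z] recip[of 0] by (simp add: cauchy_series_def)
    ultimately show "\<exists>S. ((\<lambda>t. (- 1 / deriv G t) * (1 / (t - z) - 1 / t)) has_sum S) {t. G t = 0}
        \<and> 1 / G z = 1 / G 0 + S"
      by blast
  qed
  then show ?thesis
    using G0 by auto
qed

end

section \<open>Eigenvalues of a rank one perturbation\<close>

locale diagonal_operator = orthonormal_basis I e
  for I :: "'i set" and e :: "'i \<Rightarrow> 'a::complex_hilbert_space" +
  fixes s :: "'i \<Rightarrow> real" and A :: "'a \<Rightarrow> 'a"
  assumes selfadjoint_A: "selfadjoint A"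
    and A_e: "n \<in> I \<Longrightarrow> A (e n) = complex_of_real (s n) *\<^sub>C e n"
begin

definition coeff :: "'a \<Rightarrow> 'a \<Rightarrow> 'i \<Rightarrow> complex" where
  "coeff a b n = cinner a (e n) * cnj (cinner b (e n))"

lemma coeff_summable: "(\<lambda>n. norm (coeff a b n)) summable_on I"
proof -
  have "coeff a b summable_on I"
    using parseval[of a b] unfolding coeff_def by (rule has_sum_imp_summable)
  then show ?thesis
    by (simp only: summable_on_iff_abs_summable_on_complex)
qed

lemma coordinate_perturbed:
  assumes "n \<in> I"
  shows "cinner (A x + rank_one_op a b x) (e n) = s n * cinner x (e n) + cinner x b * cinner a (e n)"
  using selfadjoint_A assms
  by (simp add: cinner_add_left rank_one_op_def cinner_scaleC_left selfadjoint_def A_e cinner_scaleC_right)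

lemma eigenvector_iff:
  "A x + rank_one_op a b x = \<mu> *\<^sub>C x \<longleftrightarrow>
    (\<forall>n\<in>I. cinner x b * cinner a (e n) = (\<mu> - s n) * cinner x (e n))"
  (is "?l \<longleftrightarrow> ?r")
proof -
  have "?l \<longleftrightarrow> (\<forall>n\<in>I. cinner (A x + rank_one_op a b x) (e n) = cinner (\<mu> *\<^sub>C x) (e n))"
    using eq_by_coordinates by metis
  also have "\<dots> \<longleftrightarrow> ?r"
    by (intro ball_cong refl) (auto simp: coordinate_perturbed cinner_scaleC_left algebra_simps)
  finally show ?thesis .
qed

lemma square_summable_divide:
  assumes "\<delta> > 0" "\<And>n. n \<in> J \<Longrightarrow> \<delta> \<le> norm (u n)" "J \<subseteq> I"
  shows "(\<lambda>n. (norm (cinner a (e n) / u n))\<^sup>2) summable_on J"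
proof (rule summable_on_comparison_test)
  show "(\<lambda>n. (norm (cinner a (e n)))\<^sup>2 * (1 / \<delta>\<^sup>2)) summable_on J"
    by (rule summable_on_cmult_left[OF summable_on_subset_banach[OF bessel assms(3)]])
  fix n assume n: "n \<in> J"
  have "norm (cinner a (e n) / u n) \<le> norm (cinner a (e n)) / \<delta>"
    unfolding norm_divide using assms(1) assms(2)[OF n] by (intro frac_le) auto
  then have "(norm (cinner a (e n) / u n))\<^sup>2 \<le> (norm (cinner a (e n)) / \<delta>)\<^sup>2"
    by (rule power_mono) simp
  then show "(norm (cinner a (e n) / u n))\<^sup>2 \<le> (norm (cinner a (e n)))\<^sup>2 * (1 / \<delta>\<^sup>2)"
    by (simp add: power_divide)
qed simp

text \<open>
  The coordinates of an eigenvector \<open>x\<close> are \<open>(x, b) a\<^sub>n / (\<mu> - s n)\<close>. Pairing with \<open>b\<close> and dividing by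
  \<open>(x, b)\<close>, which is not zero, gives the equation for \<open>\<mu>\<close>; conversely these coordinates
  with \<open>(x, b) = 1\<close> define an eigenvector.
\<close>
lemma eigenvalue_off_spectrum:
  fixes \<mu> :: complex
  assumes \<delta>: "\<delta> > 0" "\<And>n. n \<in> I \<Longrightarrow> \<delta> \<le> norm (\<mu> - s n)"
  shows "\<mu> \<in> point_spectrum (\<lambda>x. A x + rank_one_op a b x) \<longleftrightarrow>
    ((\<lambda>n. coeff a b n / (\<mu> - s n)) has_sum 1) I"
proof
  have nz: "\<mu> - complex_of_real (s n) \<noteq> 0" if "n \<in> I" for n
    using \<delta>(1) \<delta>(2)[OF that] by auto
  assume "\<mu> \<in> point_spectrum (\<lambda>x. A x + rank_one_op a b x)"
  then obtain x where x: "x \<noteq> 0" "A x + rank_one_op a b x = \<mu> *\<^sub>C x"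
    by (auto simp: point_spectrum_def eigenspace_def)
  have xn: "cinner x (e n) = cinner x b * (cinner a (e n) / (\<mu> - s n))" if "n \<in> I" for n
    using x(2)[unfolded eigenvector_iff] that nz[OF that] by (simp add: field_simps)
  have xb: "cinner x b \<noteq> 0"
    using x(1) xn total[of x] by auto
  have "((\<lambda>n. cinner x (e n) * cnj (cinner b (e n))) has_sum cinner x b) I"
    by (rule parseval)
  also have "?this \<longleftrightarrow> ((\<lambda>n. cinner x b * (coeff a b n / (\<mu> - s n))) has_sum cinner x b) I"
    by (rule has_sum_cong) (simp add: xn coeff_def)
  finally show "((\<lambda>n. coeff a b n / (\<mu> - s n)) has_sum 1) I"
    using xb by (simp add: has_sum_cmult_right_iff del: times_divide_eq_right)
next
  have nz: "\<mu> - complex_of_real (s n) \<noteq> 0" if "n \<in> I" for n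
    using \<delta>(1) \<delta>(2)[OF that] by auto
  assume hs: "((\<lambda>n. coeff a b n / (\<mu> - s n)) has_sum 1) I"
  have sq: "(\<lambda>n. (norm (cinner a (e n) / (\<mu> - s n)))\<^sup>2) summable_on I"
    by (rule square_summable_divide[OF \<delta>(1)]) (use \<delta>(2) in auto)
  obtain x where x: "\<And>n. n \<in> I \<Longrightarrow> cinner x (e n) = cinner a (e n) / (\<mu> - s n)"
    by (rule riesz_fischer[OF sq]) (rule that)
  have "((\<lambda>n. cinner x (e n) * cnj (cinner b (e n))) has_sum cinner x b) I"
    by (rule parseval)
  then have "((\<lambda>n. coeff a b n / (\<mu> - s n)) has_sum cinner x b) I"
    by (simp add: x coeff_def cong: has_sum_cong)
  then have xb: "cinner x b = 1"
    using hs by (rule has_sum_unique)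
  then have "x \<noteq> 0"
    by auto
  moreover have "A x + rank_one_op a b x = \<mu> *\<^sub>C x"
    unfolding eigenvector_iff using nz by (simp add: xb x)
  ultimately show "\<mu> \<in> point_spectrum (\<lambda>x. A x + rank_one_op a b x)"
    by (auto simp: point_spectrum_def eigenspace_def)
qed

text \<open>
  At an eigenvalue \<open>s m\<close> the \<open>m\<close>-th equation reads \<open>(x, b) a\<^sub>m = 0\<close>. If \<open>a\<^sub>m\<close> and \<open>b\<^sub>m\<close> are
  nonzero, this forces \<open>(x, b) = 0\<close>, then \<open>x\<close> to be a multiple of \<open>e m\<close>, then \<open>x = 0\<close>. If \<open>b\<^sub>m = 0\<close>,
  then \<open>e m\<close> is an eigenvector; otherwise \<open>a\<^sub>m = 0\<close> and the coordinate \<open>x\<^sub>m\<close> is free, which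
  makes it possible to reach \<open>(x, b) = 1\<close>.
\<close>
lemma eigenvalue_at_spectrum:
  assumes m: "m \<in> I" and \<delta>: "\<delta> > 0" "\<And>n. n \<in> I - {m} \<Longrightarrow> \<delta> \<le> norm (complex_of_real (s m) - s n)"
  shows "complex_of_real (s m) \<in> point_spectrum (\<lambda>x. A x + rank_one_op a b x) \<longleftrightarrow> coeff a b m = 0"
proof
  have nz: "complex_of_real (s m) - complex_of_real (s n) \<noteq> 0" if "n \<in> I - {m}" for n
    using \<delta>(1) \<delta>(2)[OF that] by auto
  assume "complex_of_real (s m) \<in> point_spectrum (\<lambda>x. A x + rank_one_op a b x)"
  then obtain x where x: "x \<noteq> 0"
    and ev: "\<And>n. n \<in> I \<Longrightarrow> cinner x b * cinner a (e n) = (complex_of_real (s m) - s n) * cinner x (e n)"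
    by (auto simp: point_spectrum_def eigenspace_def eigenvector_iff)
  show "coeff a b m = 0"
  proof (rule ccontr)
    assume "coeff a b m \<noteq> 0"
    then have am: "cinner a (e m) \<noteq> 0" and bm: "cinner b (e m) \<noteq> 0"
      by (auto simp: coeff_def)
    have xb: "cinner x b = 0"
      using ev[OF m] am by simp
    have xn: "cinner x (e n) = 0" if "n \<in> I - {m}" for n
      using ev[of n] nz[OF that] that xb by simp
    have "((\<lambda>n. cinner x (e n) * cnj (cinner b (e n))) has_sum cinner x b) I"
      by (rule parseval)
    moreover have "((\<lambda>n. cinner x (e n) * cnj (cinner b (e n))) has_sum
        cinner x (e m) * cnj (cinner b (e m))) I"
      by (rule has_sum_finite_neutralI[of "{m}"]) (use m xn in auto)
    ultimately have "cinner x (e m) * cnj (cinner b (e m)) = 0"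
      using xb has_sum_unique by metis
    then have "cinner x (e m) = 0"
      using bm by simp
    then have "x = 0"
      using xn by (intro total) (metis Diff_iff singletonD)
    then show False
      using x by blast
  qed
next
  have nz: "complex_of_real (s m) - complex_of_real (s n) \<noteq> 0" if "n \<in> I - {m}" for n
    using \<delta>(1) \<delta>(2)[OF that] by auto
  assume c0: "coeff a b m = 0"
  have "\<exists>x. x \<noteq> 0 \<and> A x + rank_one_op a b x = complex_of_real (s m) *\<^sub>C x"
  proof (cases "cinner b (e m) = 0")
    case True
    then have "cinner (e m) b = 0"
      using cinner_commute[of "e m" b] by simp
    then have "A (e m) + rank_one_op a b (e m) = complex_of_real (s m) *\<^sub>C e m"
      using A_e[OF m] by (simp add: rank_one_op_def complex_vector.scale_zero_left)
    moreover have "e m \<noteq> 0"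
      using norm_e[OF m] by auto
    ultimately show ?thesis
      by blast
  next
    case False
    then have am: "cinner a (e m) = 0"
      using c0 by (simp add: coeff_def)
    define J where "J = I - {m}"
    define \<alpha> where "\<alpha> n = cinner a (e n) / (complex_of_real (s m) - s n)" for n
    have sq: "(\<lambda>n. (norm (\<alpha> n))\<^sup>2) summable_on J"
      unfolding \<alpha>_def J_def by (rule square_summable_divide[OF \<delta>]) auto
    have IJ: "I = insert m J" "m \<notin> J"
      using m by (auto simp: J_def)
    obtain y where y: "\<And>n. n \<in> I \<Longrightarrow> cinner y (e n) = (if n = m then 0 else \<alpha> n)"
    proof (rule riesz_fischer)
      have "(\<lambda>n. (norm (if n = m then 0 else \<alpha> n))\<^sup>2) summable_on J"
        using sq by (rule summable_on_cong[THEN iffD2, rotated]) (auto simp: J_def)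
      then show "(\<lambda>n. (norm (if n = m then 0 else \<alpha> n))\<^sup>2) summable_on I"
        unfolding IJ(1) by (simp only: summable_on_insert_iff)
    qed (use that in blast)
    define c where "c = (1 - cinner y b) / cinner (e m) b"
    have emb: "cinner (e m) b \<noteq> 0"
      using False cinner_commute[of "e m" b] by simp
    define x where "x = y + c *\<^sub>C e m"
    have xb: "cinner x b = 1"
      using emb by (simp add: x_def c_def cinner_add_left cinner_scaleC_left)
    then have "x \<noteq> 0"
      by auto
    moreover have "cinner x b * cinner a (e n) = (complex_of_real (s m) - s n) * cinner x (e n)"
      if n: "n \<in> I" for n
    proof (cases "n = m")
      case True
      then show ?thesis
        by (simp add: am)
    next
      case False
      have "cinner x (e n) = \<alpha> n"
        using n m False by (simp add: x_def cinner_add_left cinner_scaleC_left y orth)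
      then show ?thesis
        using nz[of n] n False by (simp add: xb \<alpha>_def)
    qed
    ultimately show ?thesis
      unfolding eigenvector_iff by blast
  qed
  then show "complex_of_real (s m) \<in> point_spectrum (\<lambda>x. A x + rank_one_op a b x)"
    by (auto simp: point_spectrum_def eigenspace_def)
qed

end

text \<open>
  The images of the orthonormal vectors under an inverse of \<open>T\<close> form a bounded family that \<open>T\<close>
  maps to a separated one, contrary to compactness.
\<close>
lemma (in orthonormal_basis) zero_in_spectrum:
  fixes T :: "'a \<Rightarrow> 'a"
  assumes "infinite I" and T: "compact_operator T"
  shows "0 \<in> op_spectrum T"
proof (rule ccontr)
  assume "0 \<notin> op_spectrum T"
  then obtain R where R: "bounded_clinear R" and TR: "\<And>x. T (R x) = x"
    by (auto simp: op_spectrum_def complex_vector.scale_zero_left)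
  obtain K where K: "\<And>x. norm (R x) \<le> norm x * K"
    using bounded_linear.bounded[OF bounded_clinearD(1)[OF R]] by blast
  obtain f :: "nat \<Rightarrow> 'i" where f: "inj f" "range f \<subseteq> I"
    using infinite_countable_subset[OF assms(1)] by blast
  show False
  proof (rule compact_operator_not_separated[OF T, of "\<lambda>k. R (e (f k))" K 1])
    show "norm (R (e (f k))) \<le> K" for k
      using K[of "e (f k)"] f(2) norm_e by (simp add: range_subsetD)
    fix j k :: nat assume "j < k"
    then have ne: "f j \<noteq> f k" and jk: "f j \<in> I" "f k \<in> I"
      using f by (auto dest: injD)
    have "1 = norm (cinner (e (f j) - e (f k)) (e (f j)))"
      using ne jk by (simp add: cinner_diff_left cinner_e)
    also have "\<dots> \<le> norm (e (f j) - e (f k)) * norm (e (f j))"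
      by (rule norm_cinner_le)
    finally show "1 \<le> norm (T (R (e (f j))) - T (R (e (f k))))"
      using jk by (simp add: norm_e TR)
  qed simp
qed

section \<open>Volterra perturbations\<close>

locale compact_diagonal = diagonal_operator I e s A + real_null_family I s
  for I :: "'i set" and e :: "'i \<Rightarrow> 'a::complex_hilbert_space" and s A +
  assumes compact_A: "compact_operator A" and infinite_I: "infinite I"
begin

lemma gap:
  assumes J: "J \<subseteq> I" and \<mu>: "\<mu> \<noteq> 0" "\<And>n. n \<in> J \<Longrightarrow> \<mu> \<noteq> complex_of_real (s n)"
  obtains \<delta> where "\<delta> > 0" "\<And>n. n \<in> J \<Longrightarrow> \<delta> \<le> norm (\<mu> - s n)"
proof -
  have "inverse \<mu> \<notin> poles s J"
    using \<mu> by (auto simp: poles_def field_simps)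
  then obtain \<delta> where \<delta>: "\<delta> > 0" "\<And>n. n \<in> J \<Longrightarrow> \<delta> \<le> norm (1 - s n * inverse \<mu>)"
    by (rule away_from_poles_at[OF J]) (rule that)
  show thesis
  proof
    show "norm \<mu> * \<delta> > 0"
      using \<mu> \<delta> by simp
    fix n assume "n \<in> J"
    then have "norm \<mu> * \<delta> \<le> norm \<mu> * norm (1 - s n * inverse \<mu>)"
      using \<delta>(2) by (intro mult_left_mono) auto
    also have "\<dots> = norm (\<mu> * (1 - s n * inverse \<mu>))"
      by (simp only: norm_mult)
    also have "\<mu> * (1 - s n * inverse \<mu>) = \<mu> - s n"
      using \<mu>(1) by (simp add: right_diff_distrib)
    finally show "norm \<mu> * \<delta> \<le> norm (\<mu> - s n)" .
  qed
qed

lemma volterra_iff_no_eigenvalue: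
  "volterra (\<lambda>x. A x + rank_one_op a b x) \<longleftrightarrow>
    (\<forall>\<mu>. \<mu> \<noteq> 0 \<longrightarrow> \<mu> \<notin> point_spectrum (\<lambda>x. A x + rank_one_op a b x))"
proof -
  have comp: "compact_operator (\<lambda>x. A x + rank_one_op a b x)"
    by (rule compact_operator_add_rank_one[OF compact_A])
  show ?thesis
    unfolding volterra_def
    using comp compact_spectrum_nonzero[OF comp] zero_in_spectrum[OF infinite_I comp] by auto
qed

text \<open>
  The function \<open>1 - cauchy_series s (coeff a b) I z\<close> is the perturbation determinant
  \<open>1 - z ((1 - z A)\<^sup>-\<^sup>1 a, b)\<close>. Its zeros are the reciprocals of the nonzero eigenvalues of
  \<open>A + a b\<^sup>*\<close> outside the family \<open>s\<close>, and vanishing coefficients account for the eigenvalues in it.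
\<close>
lemma volterra_iff_zero_free:
  "volterra (\<lambda>x. A x + rank_one_op a b x) \<longleftrightarrow> zero_free_series I s (coeff a b)"
  (is "?V \<longleftrightarrow> ?Z")
proof -
  have series: "((\<lambda>n. coeff a b n / (\<mu> - s n)) has_sum 1) I \<longleftrightarrow> cauchy_series s (coeff a b) I (inverse \<mu>) = 1"
    if \<mu>: "\<mu> \<noteq> 0" "inverse \<mu> \<notin> poles s I" for \<mu>
  proof -
    have "((\<lambda>n. coeff a b n * (inverse \<mu> / (1 - s n * inverse \<mu>))) has_sum
        cauchy_series s (coeff a b) I (inverse \<mu>)) I"
      by (rule cauchy_series_has_sum[OF order_refl coeff_summable \<mu>(2)])
    also have "(\<lambda>n. coeff a b n * (inverse \<mu> / (1 - s n * inverse \<mu>))) = (\<lambda>n. coeff a b n / (\<mu> - s n))"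
      using \<mu>(1) by (simp add: fun_eq_iff divide_simps)
    finally show ?thesis
      using has_sum_unique by metis
  qed
  have off: "inverse \<mu> \<notin> poles s I \<longleftrightarrow> (\<forall>n\<in>I. \<mu> \<noteq> complex_of_real (s n))" if "\<mu> \<noteq> 0" for \<mu>
    using that by (auto simp: poles_def field_simps)
  have at: "complex_of_real (s m) \<in> point_spectrum (\<lambda>x. A x + rank_one_op a b x) \<longleftrightarrow> coeff a b m = 0"
    if m: "m \<in> I" for m
  proof -
    have "complex_of_real (s m) \<noteq> complex_of_real (s n)" if "n \<in> I - {m}" for n
      using inj m that by (auto dest: inj_onD)
    then obtain \<delta> where "\<delta> > 0" "\<And>n. n \<in> I - {m} \<Longrightarrow> \<delta> \<le> norm (complex_of_real (s m) - s n)"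
      using gap[of "I - {m}" "complex_of_real (s m)"] nonzero[OF m] by auto
    then show ?thesis
      by (rule eigenvalue_at_spectrum[OF m])
  qed
  have off_eig: "\<mu> \<in> point_spectrum (\<lambda>x. A x + rank_one_op a b x) \<longleftrightarrow>
      cauchy_series s (coeff a b) I (inverse \<mu>) = 1" if \<mu>: "\<mu> \<noteq> 0" "inverse \<mu> \<notin> poles s I" for \<mu>
  proof -
    obtain \<delta> where "\<delta> > 0" "\<And>n. n \<in> I \<Longrightarrow> \<delta> \<le> norm (\<mu> - s n)"
      using gap[OF order_refl \<mu>(1)] off[OF \<mu>(1)] \<mu>(2) by metis
    then show ?thesis
      using eigenvalue_off_spectrum series[OF \<mu>] by simp
  qed
  show ?thesis
  proof
    assume ?V
    then have no: "\<mu> \<notin> point_spectrum (\<lambda>x. A x + rank_one_op a b x)" if "\<mu> \<noteq> 0" for \<mu>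
      using that by (simp add: volterra_iff_no_eigenvalue)
    show ?Z
    proof
      show "(\<lambda>n. norm (coeff a b n)) summable_on I"
        by (rule coeff_summable)
      show "coeff a b n \<noteq> 0" if "n \<in> I" for n
        using no[of "complex_of_real (s n)"] at[OF that] nonzero[OF that] by simp
      show "cauchy_series s (coeff a b) I z \<noteq> 1" if z: "z \<notin> poles s I" for z
      proof (cases "z = 0")
        case True
        then show ?thesis
          by (simp add: cauchy_series_def)
      next
        case False
        then show ?thesis
          using off_eig[of "inverse z"] no[of "inverse z"] z by simp
      qed
    qed
  next
    assume ?Z
    then interpret zero_free_series I s "coeff a b" .
    show ?V
      unfolding volterra_iff_no_eigenvalue
    proof (intro allI impI)
      fix \<mu> :: complex assume \<mu>: "\<mu> \<noteq> 0"
      show "\<mu> \<notin> point_spectrum (\<lambda>x. A x + rank_one_op a b x)"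
      proof (cases "inverse \<mu> \<in> poles s I")
        case True
        then obtain n where "n \<in> I" "\<mu> = complex_of_real (s n)"
          using off[OF \<mu>] by blast
        then show ?thesis
          using at d_nonzero by blast
      next
        case False
        then show ?thesis
          using off_eig[OF \<mu>] zero_free by blast
      qed
    qed
  qed
qed

text \<open>Split \<open>d n\<close> into two factors of modulus \<open>sqrt |d n|\<close>; both are square summable.\<close>
lemma coeff_surj:
  fixes d :: "'i \<Rightarrow> complex"
  assumes d: "(\<lambda>n. norm (d n)) summable_on I"
  obtains a b where "\<And>n. n \<in> I \<Longrightarrow> coeff a b n = d n"
proof -
  define r where "r n = sqrt (norm (d n))" for n
  have r2: "(r n)\<^sup>2 = norm (d n)" for n
    by (simp add: r_def)
  obtain a where a: "\<And>n. n \<in> I \<Longrightarrow> cinner a (e n) = complex_of_real (r n)"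
    by (rule riesz_fischer[of "\<lambda>n. complex_of_real (r n)"]) (use d r2 that in auto)
  obtain b where b: "\<And>n. n \<in> I \<Longrightarrow> cinner b (e n) = cnj (d n) / complex_of_real (r n)"
  proof (rule riesz_fischer[of "\<lambda>n. cnj (d n) / complex_of_real (r n)"])
    have "(norm (cnj (d n) / complex_of_real (r n)))\<^sup>2 = norm (d n)" for n
      by (simp add: norm_divide power_divide r2) (simp add: power2_eq_square)
    then show "(\<lambda>n. (norm (cnj (d n) / complex_of_real (r n)))\<^sup>2) summable_on I"
      using d by simp
  qed (use that in blast)
  have "coeff a b n = d n" if "n \<in> I" for n
    using that by (cases "d n = 0") (simp_all add: coeff_def a b r_def)
  then show thesis ..
qed

text \<open>The residues of \<open>1 / F\<close>, scaled by \<open>F(0)\<close>, give coefficients for which \<open>\<phi> = F(0) / F\<close>.\<close>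
lemma krein_class_imp_zero_free:
  assumes F: "F \<in> krein_class" and Z: "{z. F z = 0} = poles s I"
  obtains d where "zero_free_series I s d"
proof -
  define c where "c t = - 1 / deriv F t" for t
  have hol: "F holomorphic_on UNIV" and F0: "F 0 \<noteq> 0"
    and ord: "\<And>z. F z = 0 \<Longrightarrow> zorder F z = 1"
    and sum: "(\<lambda>t. norm (c t) / (norm t)\<^sup>2) summable_on poles s I"
    and series: "\<And>z. z \<notin> poles s I \<Longrightarrow>
      \<exists>S. ((\<lambda>t. c t * (1 / (t - z) - 1 / t)) has_sum S) (poles s I) \<and> 1 / F z = 1 / F 0 + S"
    using F[unfolded krein_class_def Let_def, THEN CollectD, unfolded Z] unfolding c_def by blast+
  define t where "t m = complex_of_real (inverse (s m))" for m
  have bij: "bij_betw t I (poles s I)"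
    unfolding bij_betw_def t_def poles_image using inj by (auto simp: inj_on_def)
  define d where "d m = - F 0 * c (t m) * (s m)\<^sup>2" for m
  have Zt: "F z = 0 \<longleftrightarrow> z \<in> poles s I" for z
    using Z by blast
  show thesis
  proof
    show "zero_free_series I s d"
    proof
      have "(\<lambda>m. norm (c (t m)) / (norm (t m))\<^sup>2) summable_on I"
        using sum summable_on_reindex_bij_betw[OF bij, of "\<lambda>t. norm (c t) / (norm t)\<^sup>2"] by simp
      then have "(\<lambda>m. norm (F 0) * (norm (c (t m)) / (norm (t m))\<^sup>2)) summable_on I"
        by (rule summable_on_cmult_right)
      moreover have "norm (F 0) * (norm (c (t m)) / (norm (t m))\<^sup>2) = norm (d m)" for m
        by (simp add: d_def t_def norm_mult norm_power norm_inverse power_inverse divide_inverse)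
      ultimately show "(\<lambda>m. norm (d m)) summable_on I"
        by simp
    next
      fix m assume m: "m \<in> I"
      have "F (t m) = 0"
        unfolding Zt using bij m by (auto simp: bij_betw_def)
      moreover have "deriv F (t m) \<noteq> 0"
        by (rule deriv_nonzero_at_simple_zero[OF hol F0 calculation ord[OF calculation]])
      ultimately show "d m \<noteq> 0"
        using F0 nonzero[OF m] by (simp add: d_def c_def)
    next
      fix z assume z: "z \<notin> poles s I"
      obtain S where S: "((\<lambda>t. c t * (1 / (t - z) - 1 / t)) has_sum S) (poles s I)" "1 / F z = 1 / F 0 + S"
        using series[OF z] by blast
      have "((\<lambda>m. c (t m) * (1 / (t m - z) - 1 / t m)) has_sum S) I"
        using S(1) has_sum_reindex_bij_betw[OF bij, of "\<lambda>t. c t * (1 / (t - z) - 1 / t)"] by simp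
      then have "((\<lambda>m. - F 0 * (c (t m) * (1 / (t m - z) - 1 / t m))) has_sum - F 0 * S) I"
        by (rule has_sum_cmult_right)
      moreover have "- F 0 * (c (t m) * (1 / (t m - z) - 1 / t m)) = d m * (z / (1 - s m * z))"
        if m: "m \<in> I" for m
      proof -
        have nz: "1 - complex_of_real (s m) * z \<noteq> 0" "complex_of_real (s m) \<noteq> 0"
          using m z nonzero[OF m] by (auto simp: poles_def)
        have tz: "t m - z = (1 - s m * z) / s m"
          using nz by (simp add: t_def field_simps)
        have "1 / (t m - z) - 1 / t m = (s m)\<^sup>2 * (z / (1 - s m * z))"
          unfolding tz using nz by (simp add: t_def power2_eq_square field_simps)
        then show ?thesis
          by (simp add: d_def)
      qed
      ultimately have "((\<lambda>m. d m * (z / (1 - s m * z))) has_sum - F 0 * S) I"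
        by (simp cong: has_sum_cong)
      then have "cauchy_series s d I z = - F 0 * S"
        unfolding cauchy_series_def by (rule infsumI)
      also have "\<dots> = 1 - F 0 * (1 / F z)"
        using F0 by (simp add: S(2) distrib_left)
      also have "\<dots> \<noteq> 1"
        using F0 z Zt by simp
      finally show "cauchy_series s d I z \<noteq> 1" .
    qed
  qed
qed

text \<open>
  The Volterra property depends on \<open>a\<close> and \<open>b\<close> only through the coefficients, and every summable
  family of coefficients is attained; what remains is the analytic equivalence between zero-free series
  and Krein's class.
\<close>
theorem volterra_perturbation_iff_krein:
  "(\<exists>a b. a \<noteq> 0 \<and> b \<noteq> 0 \<and> volterra (\<lambda>x. A x + rank_one_op a b x))
    \<longleftrightarrow> (\<exists>F\<in>krein_class. {z. F z = 0} = poles s I)"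
proof
  assume "\<exists>a b. a \<noteq> 0 \<and> b \<noteq> 0 \<and> volterra (\<lambda>x. A x + rank_one_op a b x)"
  then obtain a b where "zero_free_series I s (coeff a b)"
    by (auto simp: volterra_iff_zero_free)
  then show "\<exists>F\<in>krein_class. {z. F z = 0} = poles s I"
    by (rule zero_free_series.krein_function_with_zeros_at_poles)
next
  assume "\<exists>F\<in>krein_class. {z. F z = 0} = poles s I"
  then obtain F where F: "F \<in> krein_class" "{z. F z = 0} = poles s I"
    by blast
  obtain d where d: "zero_free_series I s d"
    by (rule krein_class_imp_zero_free[OF F]) (rule that)
  then interpret zero_free_series I s d .
  obtain a b where ab: "\<And>n. n \<in> I \<Longrightarrow> coeff a b n = d n"
    by (rule coeff_surj[OF summable_d]) (rule that)
  have "zero_free_series I s (coeff a b)"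
  proof
    show "cauchy_series s (coeff a b) I z \<noteq> 1" if "z \<notin> poles s I" for z
      using zero_free[OF that] by (simp add: cauchy_series_def ab cong: infsum_cong)
  qed (simp_all add: coeff_summable ab d_nonzero)
  then have V: "volterra (\<lambda>x. A x + rank_one_op a b x)"
    by (simp add: volterra_iff_zero_free)
  obtain n where n: "n \<in> I"
    using infinite_I by (metis finite.emptyI ex_in_conv)
  have "coeff a b n \<noteq> 0"
    using ab[OF n] d_nonzero[OF n] by simp
  then have "a \<noteq> 0" "b \<noteq> 0"
    by (auto simp: coeff_def)
  then show "\<exists>a b. a \<noteq> 0 \<and> b \<noteq> 0 \<and> volterra (\<lambda>x. A x + rank_one_op a b x)"
    using V by blast
qed

end

text \<open>
  The filter expresses \<open>|n| \<rightarrow> \<infinity>\<close> within \<open>I\<close>, and only finitely many integers have bounded modulus.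
\<close>
lemma null_family_finite:
  fixes s :: "int \<Rightarrow> real"
  assumes lim: "((\<lambda>n. \<bar>s n\<bar>) \<longlongrightarrow> 0) (inf (filtercomap abs at_top) (principal I))" and \<epsilon>: "\<epsilon> > 0"
  shows "finite {n \<in> I. \<epsilon> \<le> \<bar>s n\<bar>}"
proof -
  have "\<forall>\<^sub>F n in inf (filtercomap abs at_top) (principal I). \<bar>s n\<bar> < \<epsilon>"
    using order_tendstoD(2)[OF lim \<epsilon>] .
  then have "\<forall>\<^sub>F n in filtercomap abs at_top. n \<in> I \<longrightarrow> \<bar>s n\<bar> < \<epsilon>"
    by (simp add: eventually_inf_principal)
  then obtain N :: int where N: "\<And>n. N \<le> \<bar>n\<bar> \<Longrightarrow> n \<in> I \<Longrightarrow> \<bar>s n\<bar> < \<epsilon>"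
    by (auto simp: eventually_filtercomap eventually_at_top_linorder)
  have "{n \<in> I. \<epsilon> \<le> \<bar>s n\<bar>} \<subseteq> {- N..N}"
  proof
    fix n assume n: "n \<in> {n \<in> I. \<epsilon> \<le> \<bar>s n\<bar>}"
    then have "\<not> N \<le> \<bar>n\<bar>"
      using N[of n] by auto
    then show "n \<in> {- N..N}"
      by auto
  qed
  then show ?thesis
    by (rule finite_subset) simp
qed

theorem theorem1p2:
  fixes I :: "int set" and s :: "int \<Rightarrow> real"
    and A :: "'a::complex_hilbert_space \<Rightarrow> 'a"
  assumes "infinite I"
    and "inj_on s I"
    and "\<forall>n\<in>I. s n \<noteq> 0"
    and "((\<lambda>n. \<bar>s n\<bar>) \<longlongrightarrow> 0) (inf (filtercomap abs at_top) (principal I))"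
    and "compact_operator A"
    and "selfadjoint A"
    and "point_spectrum A = (\<lambda>n. complex_of_real (s n)) ` I"
    and "simple_point_spectrum A"
  shows "(\<exists>a b. a \<noteq> 0 \<and> b \<noteq> 0 \<and> volterra (\<lambda>x. A x + rank_one_op a b x))
     \<longleftrightarrow> (\<exists>F\<in>krein_class. {z. F z = 0} = (\<lambda>n. complex_of_real (inverse (s n))) ` I)"
proof -
  obtain e where e: "orthonormal_basis I e" "\<And>n. n \<in> I \<Longrightarrow> A (e n) = complex_of_real (s n) *\<^sub>C e n"
    by (rule selfadjoint_compact_eigenbasis[OF assms(2,3,5-8)]) (rule that)
  interpret orthonormal_basis I e
    by (rule e(1))
  interpret compact_diagonal I e s A
    by unfold_locales
      (use assms e(2) null_family_finite[OF assms(4)] in auto)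
  show ?thesis
    using volterra_perturbation_iff_krein unfolding poles_image .
qed

end
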